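(* Let $f$ be a regular function on a symmetric slice domain $\Omega\subseteq\mathbb{H}$, and let $q_0\in\Omega$. Set $A_1=R_{q_0}f(\bar q_0)$ and $A_2=R_{\bar q_0}R_{q_0}f(q_0)$. For all $v\in\mathbb{H}$ with $|v|=1$, the derivative of $f$ along $v$ can be computed at $q_0$ as $$\lim_{t\to0}\frac{f(q_0+tv)-f(q_0)}{t}=vA_1+(q_0v-v\bar q_0)A_2$$ (with $t$ real). In particular, if $e_0,e_1,e_2,e_3\in\mathbb{H}$ form a basis for $\mathbb{H}$ (as a real vector space) and if $x_0,x_1,x_2,x_3$ denote the corresponding real coordinates, then for each $i\in\{0,1,2,3\}$ $$\frac{\partial f}{\partial x_i}(q_0)=e_iR_{q_0}f(\bar q_0)+(q_0e_i-e_i\bar q_0)R_{\bar q_0}R_{q_0}f(q_0).$$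
   Context: $\mathbb{H}$ is the real algebra of quaternions with conjugation $q\mapsto\bar q$ and modulus $|\cdot|$; $\mathbb{S}=\{q\in\mathbb{H}:q^2=-1\}$; for $I\in\mathbb{S}$, $L_I=\mathbb{R}+I\mathbb{R}\simeq\mathbb{C}$. For a domain (connected open set) $\Omega\subseteq\mathbb{H}$ and $f:\Omega\to\mathbb{H}$, put $\Omega_I=\Omega\cap L_I$, $f_I=f|_{\Omega_I}$. The function $f$ is (slice) regular if for every $I\in\mathbb{S}$ the restriction $f_I$ is holomorphic, i.e. $\frac12\left(\frac{\partial}{\partial x}+I\frac{\partial}{\partial y}\right)f_I(x+Iy)=0$ identically on $\Omega_I$. A domain $\Omega$ is a slice domain if it intersects the real axis and $\Omega_I$ is a domain in $L_I$ for all $I\in\mathbb{S}$; it is symmetric if $x+Iy\in\Omega$ (with $x,y\in\mathbb{R}$, $I\in\mathbb{S}$) implies $x+y\mathbb{S}=\{x+yJ:J\in\mathbb{S}\}\subseteq\Omega$. Regular product: if $f,g$ are regular on a symmetric slice domain $\Omega$, choose $I,J\in\mathbb{S}$ with $I\perp J$ and write $f_I=F+GJ$, $g_I=H+KJ$ with $F,G,H,K:\Omega_I\to L_I$ holomorphic; $f*g$ is the unique regular function on $\Omega$ whose restriction to $\Omega_I$ is $[F(z)H(z)-G(z)\overline{K(\bar z)}]+[F(z)K(z)+G(z)\overline{H(\bar z)}]J$ (independent of the choice of $I,J$). It extends the product $\left(\sum q^na_n\right)*\left(\sum q^nb_n\right)=\sum q^n\sum_{k=0}^na_kb_{n-k}$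 of power series. Operator $R_{q_0}$: for $f$ regular on a symmetric slice domain $\Omega$ and $q_0\in\Omega$, $R_{q_0}f:\Omega\to\mathbb{H}$ denotes the (unique, known to exist) regular function such that $f(q)=f(q_0)+(q-q_0)*R_{q_0}f(q)$ on $\Omega$. (If $q_0\in L_I$, then $f(z)=f(q_0)+(z-q_0)R_{q_0}f(z)$ for $z\in\Omega_I$.) $R_{\bar q_0}R_{q_0}f$ means $R_{\bar q_0}$ applied to $R_{q_0}f$. *)

theory Defs
  imports "HOL-Analysis.Analysis"
begin

section \<open>Quaternions\<close>

datatype quat = Quat (qRe: real) (qIm1: real) (qIm2: real) (qIm3: real)

lemma quat_eq_iff: "x = y \<longleftrightarrow> qRe x = qRe y \<and> qIm1 x = qIm1 y \<and> qIm2 x = qIm2 y \<and> qIm3 x = qIm3 y"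
  by (cases x; cases y; simp)

instantiation quat :: ab_group_add
begin

definition "0 = Quat 0 0 0 0"
definition "x + y = Quat (qRe x + qRe y) (qIm1 x + qIm1 y) (qIm2 x + qIm2 y) (qIm3 x + qIm3 y)"
definition "- x = Quat (- qRe x) (- qIm1 x) (- qIm2 x) (- qIm3 x)"
definition "x - y = Quat (qRe x - qRe y) (qIm1 x - qIm1 y) (qIm2 x - qIm2 y) (qIm3 x - qIm3 y)"

lemma quat_zero_sel [simp]: "qRe 0 = 0" "qIm1 0 = 0" "qIm2 0 = 0" "qIm3 0 = 0"
  by (simp_all add: zero_quat_def)

lemma quat_plus_sel [simp]:
  "qRe (x + y) = qRe x + qRe y" "qIm1 (x + y) = qIm1 x + qIm1 y"
  "qIm2 (x + y) = qIm2 x + qIm2 y" "qIm3 (x + y) = qIm3 x + qIm3 y"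
  by (simp_all add: plus_quat_def)

lemma quat_uminus_sel [simp]:
  "qRe (- x) = - qRe x" "qIm1 (- x) = - qIm1 x" "qIm2 (- x) = - qIm2 x" "qIm3 (- x) = - qIm3 x"
  by (simp_all add: uminus_quat_def)

lemma quat_minus_sel [simp]:
  "qRe (x - y) = qRe x - qRe y" "qIm1 (x - y) = qIm1 x - qIm1 y"
  "qIm2 (x - y) = qIm2 x - qIm2 y" "qIm3 (x - y) = qIm3 x - qIm3 y"
  by (simp_all add: minus_quat_def)

instance
  by standard (simp_all add: quat_eq_iff)

end

instantiation quat :: real_vector
begin

definition "r *\<^sub>R x = Quat (r * qRe x) (r * qIm1 x) (r * qIm2 x) (r * qIm3 x)"

lemma quat_scaleR_sel [simp]:
  "qRe (r *\<^sub>R x) = r * qRe x" "qIm1 (r *\<^sub>R x) = r * qIm1 x"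
  "qIm2 (r *\<^sub>R x) = r * qIm2 x" "qIm3 (r *\<^sub>R x) = r * qIm3 x"
  by (simp_all add: scaleR_quat_def)

instance
  by standard (simp_all add: quat_eq_iff algebra_simps)

end

instantiation quat :: real_algebra_1
begin

definition "1 = Quat 1 0 0 0"

definition "x * y = Quat
  (qRe x * qRe y - qIm1 x * qIm1 y - qIm2 x * qIm2 y - qIm3 x * qIm3 y)
  (qRe x * qIm1 y + qIm1 x * qRe y + qIm2 x * qIm3 y - qIm3 x * qIm2 y)
  (qRe x * qIm2 y - qIm1 x * qIm3 y + qIm2 x * qRe y + qIm3 x * qIm1 y)
  (qRe x * qIm3 y + qIm1 x * qIm2 y - qIm2 x * qIm1 y + qIm3 x * qRe y)"

lemma quat_one_sel [simp]: "qRe 1 = 1" "qIm1 1 = 0" "qIm2 1 = 0" "qIm3 1 = 0"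
  by (simp_all add: one_quat_def)

lemma quat_times_sel [simp]:
  "qRe (x * y) = qRe x * qRe y - qIm1 x * qIm1 y - qIm2 x * qIm2 y - qIm3 x * qIm3 y"
  "qIm1 (x * y) = qRe x * qIm1 y + qIm1 x * qRe y + qIm2 x * qIm3 y - qIm3 x * qIm2 y"
  "qIm2 (x * y) = qRe x * qIm2 y - qIm1 x * qIm3 y + qIm2 x * qRe y + qIm3 x * qIm1 y"
  "qIm3 (x * y) = qRe x * qIm3 y + qIm1 x * qIm2 y - qIm2 x * qIm1 y + qIm3 x * qRe y"
  by (simp_all add: times_quat_def)

instance
  by standard (simp_all add: quat_eq_iff algebra_simps)

end

instantiation quat :: division_ring
begin

definition "inverse x =
  (let n = (qRe x)\<^sup>2 + (qIm1 x)\<^sup>2 + (qIm2 x)\<^sup>2 + (qIm3 x)\<^sup>2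
   in Quat (qRe x / n) (- qIm1 x / n) (- qIm2 x / n) (- qIm3 x / n))"
definition "x div y = x * inverse y" for x y :: quat

instance
proof
  fix x y :: quat
  show "inverse x * x = 1" "x * inverse x = 1" if "x \<noteq> 0"
  proof -
    define n where "n = (qRe x)\<^sup>2 + (qIm1 x)\<^sup>2 + (qIm2 x)\<^sup>2 + (qIm3 x)\<^sup>2"
    have n: "n \<noteq> 0"
      using that unfolding n_def quat_eq_iff
      by (smt (verit) quat_zero_sel zero_less_power2 zero_le_power2)
    have inv: "inverse x = Quat (qRe x / n) (- qIm1 x / n) (- qIm2 x / n) (- qIm3 x / n)"
      by (simp add: inverse_quat_def n_def Let_def)
    have *: "qRe x * qRe x / n + qIm1 x * qIm1 x / n + qIm2 x * qIm2 x / n + qIm3 x * qIm3 x / n = 1"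
      using n by (simp add: add_divide_distrib [symmetric] n_def power2_eq_square)
    show "inverse x * x = 1" "x * inverse x = 1"
      using * by (simp_all add: quat_eq_iff inv algebra_simps)
  qed
  show "x div y = x * inverse y" by (rule divide_quat_def)
  show "inverse (0 :: quat) = 0" by (simp add: inverse_quat_def quat_eq_iff)
qed

end

lemma quat_of_real_sel [simp]:
  "qRe (of_real r) = r" "qIm1 (of_real r) = 0" "qIm2 (of_real r) = 0" "qIm3 (of_real r) = 0"
  by (simp_all add: of_real_def)

instantiation quat :: real_inner
begin

definition "inner x y = qRe x * qRe y + qIm1 x * qIm1 y + qIm2 x * qIm2 y + qIm3 x * qIm3 y"
definition "norm x = sqrt ((qRe x)\<^sup>2 + (qIm1 x)\<^sup>2 + (qIm2 x)\<^sup>2 + (qIm3 x)\<^sup>2)" for x :: quat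
definition "sgn x = x /\<^sub>R norm x" for x :: quat
definition "dist x y = norm (x - y)" for x y :: quat
definition "(uniformity :: (quat \<times> quat) filter) = (INF e\<in>{0 <..}. principal {(x, y). dist x y < e})"
definition "open (U :: quat set) \<longleftrightarrow>
  (\<forall>x\<in>U. eventually (\<lambda>(x', y). x' = x \<longrightarrow> y \<in> U) uniformity)"

instance
proof
  fix x y z :: quat and r :: real
  show "inner x x = 0 \<longleftrightarrow> x = 0"
    unfolding inner_quat_def quat_eq_iff
    by (smt (verit) quat_zero_sel mult_eq_0_iff zero_le_square)
qed (auto simp: inner_quat_def norm_quat_def sgn_quat_def dist_quat_def uniformity_quat_def
      open_quat_def algebra_simps power2_eq_square)

end

instance quat :: real_normed_div_algebra
proof
  fix x y :: quat
  show "norm (x * y) = norm x * norm y"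
    unfolding norm_quat_def real_sqrt_mult [symmetric]
    by (rule arg_cong [where f = sqrt]) (simp add: algebra_simps power2_eq_square)
qed

instantiation quat :: euclidean_space
begin

definition "Basis = {1, Quat 0 1 0 0, Quat 0 0 1 0, Quat 0 0 0 1}"

instance
proof
  fix u v x :: quat
  show "(Basis :: quat set) \<noteq> {}" "finite (Basis :: quat set)"
    by (simp_all add: Basis_quat_def)
  show "u \<in> Basis \<Longrightarrow> v \<in> Basis \<Longrightarrow> inner u v = (if u = v then 1 else 0)"
    by (auto simp: Basis_quat_def inner_quat_def quat_eq_iff)
  show "(\<forall>u\<in>Basis. inner x u = 0) \<longleftrightarrow> x = 0"
    unfolding quat_eq_iff [of x 0] by (auto simp: Basis_quat_def inner_quat_def)
qed

end

definition qcnj :: "quat \<Rightarrow> quat" where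
  "qcnj q = Quat (qRe q) (- qIm1 q) (- qIm2 q) (- qIm3 q)"

section \<open>Slices, slice domains and regular functions\<close>

definition imag_units :: "quat set" where
  "imag_units = {q. q\<^sup>2 = - 1}"

definition slice :: "quat \<Rightarrow> quat set" where
  "slice I = {of_real x + I * of_real y | x y. True}"

definition slice_domain :: "quat set \<Rightarrow> bool" where
  "slice_domain \<Omega> \<longleftrightarrow> open \<Omega> \<and> connected \<Omega> \<and> \<Omega> \<inter> \<real> \<noteq> {} \<and>
     (\<forall>I\<in>imag_units. openin (top_of_set (slice I)) (\<Omega> \<inter> slice I) \<and> connected (\<Omega> \<inter> slice I))"

definition symmetric_set :: "quat set \<Rightarrow> bool" where
  "symmetric_set \<Omega> \<longleftrightarrow>
     (\<forall>x y. \<forall>I\<in>imag_units. of_real x + I * of_real y \<in> \<Omega> \<longrightarrow>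
        (\<forall>J\<in>imag_units. of_real x + of_real y * J \<in> \<Omega>))"

text \<open>
  Holomorphy on a (relatively open) subset \<open>U\<close> of \<open>slice I\<close>: with \<open>D\<close> the real differential of
  \<open>(x, y) \<mapsto> f (x + I y)\<close>, the partial derivatives are \<open>D (1, 0)\<close> and \<open>D (0, 1)\<close>, and the
  Cauchy-Riemann operator uses multiplication by \<open>I\<close> on the left.
\<close>

definition holomorphic_on_slice :: "quat \<Rightarrow> quat set \<Rightarrow> (quat \<Rightarrow> quat) \<Rightarrow> bool" where
  "holomorphic_on_slice I U f \<longleftrightarrow>
     (\<forall>x y. of_real x + I * of_real y \<in> U \<longrightarrow>
        (\<exists>D. ((\<lambda>(s, t). f (of_real s + I * of_real t)) has_derivative D) (at (x, y)) \<and>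
             (1 / 2) *\<^sub>R (D (1, 0) + I * D (0, 1)) = 0))"

definition slice_regular_on :: "quat set \<Rightarrow> (quat \<Rightarrow> quat) \<Rightarrow> bool" where
  "slice_regular_on \<Omega> f \<longleftrightarrow> (\<forall>I\<in>imag_units. holomorphic_on_slice I (\<Omega> \<inter> slice I) f)"

section \<open>The regular product and the operator \<open>R\<close>\<close>

definition slice_splitting ::
    "quat set \<Rightarrow> quat \<Rightarrow> quat \<Rightarrow> (quat \<Rightarrow> quat) \<Rightarrow> (quat \<Rightarrow> quat) \<Rightarrow> (quat \<Rightarrow> quat) \<Rightarrow> bool" where
  "slice_splitting \<Omega> I J f F G \<longleftrightarrow>
     holomorphic_on_slice I (\<Omega> \<inter> slice I) F \<and> holomorphic_on_slice I (\<Omega> \<inter> slice I) G \<and>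
     (\<forall>z\<in>\<Omega> \<inter> slice I. F z \<in> slice I \<and> G z \<in> slice I \<and> f z = F z + G z * J)"

text \<open>
  Functions on \<open>\<Omega>\<close> are total functions whose values outside \<open>\<Omega>\<close> are irrelevant. So that
  \<open>THE\<close> denotes a function that is unique only on \<open>\<Omega>\<close>, the values outside \<open>\<Omega>\<close> are fixed by
  \<^const>\<open>extensional\<close>. The product formula is required for every \<open>I \<bottom> J\<close>, since it does not
  depend on that choice; the splittings are unique on \<open>\<Omega> \<inter> slice I\<close>.
\<close>

definition regular_prod ::
    "quat set \<Rightarrow> (quat \<Rightarrow> quat) \<Rightarrow> (quat \<Rightarrow> quat) \<Rightarrow> quat \<Rightarrow> quat" where
  "regular_prod \<Omega> f g = (THE h. h \<in> extensional \<Omega> \<and> slice_regular_on \<Omega> h \<and>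
     (\<forall>I\<in>imag_units. \<forall>J\<in>imag_units. inner I J = 0 \<longrightarrow>
       (\<forall>F G H K. slice_splitting \<Omega> I J f F G \<and> slice_splitting \<Omega> I J g H K \<longrightarrow>
         (\<forall>z\<in>\<Omega> \<inter> slice I.
            h z = (F z * H z - G z * qcnj (K (qcnj z)))
                + (F z * K z + G z * qcnj (H (qcnj z))) * J))))"

definition R_op :: "quat set \<Rightarrow> quat \<Rightarrow> (quat \<Rightarrow> quat) \<Rightarrow> quat \<Rightarrow> quat" where
  "R_op \<Omega> q0 f = (THE g. g \<in> extensional \<Omega> \<and> slice_regular_on \<Omega> g \<and>
     (\<forall>q\<in>\<Omega>. f q = f q0 + regular_prod \<Omega> (\<lambda>p. p - q0) g q))"

section \<open>Partial derivatives with respect to a real basis\<close>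

definition quat_basis :: "(nat \<Rightarrow> quat) \<Rightarrow> bool" where
  "quat_basis e \<longleftrightarrow>
     inj_on e {..<4} \<and> independent (e ` {..<4}) \<and> span (e ` {..<4}) = UNIV"

definition coord :: "(nat \<Rightarrow> quat) \<Rightarrow> quat \<Rightarrow> nat \<Rightarrow> real" where
  "coord e q j = representation (e ` {..<4}) q (e j)"

definition has_partial_derivative ::
    "(nat \<Rightarrow> quat) \<Rightarrow> nat \<Rightarrow> (quat \<Rightarrow> quat) \<Rightarrow> quat \<Rightarrow> quat \<Rightarrow> bool" where
  "has_partial_derivative e i f d q \<longleftrightarrow>
     ((\<lambda>t. f (\<Sum>j<4. ((coord e q)(i := t)) j *\<^sub>R e j)) has_vector_derivative d) (at (coord e q i))"

end

theory Submission
  imports Defs "HOL-Complex_Analysis.Complex_Analysis"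
begin

text \<open>
  Everything rests on the fact that a regular function on a symmetric slice domain is a slice
  function: there are \<open>a\<close> and \<open>b\<close> with \<open>f (x + J y) = a (x, y) + J b (x, y)\<close> for all
  imaginary units \<open>J\<close> at once (\<open>representation_formula\<close>). Two slice functions that agree on one
  slice \<open>L\<^sub>I\<close> agree everywhere (\<open>slice_function_eqI\<close>), because \<open>J = I\<close> and \<open>J = - I\<close> already
  determine \<open>a\<close> and \<open>b\<close>. So identities between regular functions need only be checked on a slice
  that contains \<open>q\<^sub>0\<close>. There \<open>q\<^sub>0\<close> commutes with the variable, and
  the regular product with \<open>q - q\<^sub>0\<close> is the pointwise product
  (\<open>regular_prod_linear_factor\<close>). Hence on this slice the operator \<open>R\<close> is the classical difference
  quotient with its singularity removed (\<open>R_op_on_slice\<close>); the extension of that quotient from the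
  slice to \<open>\<Omega>\<close> is regular.

  Applying \<open>R\<close> at \<open>q\<^sub>0\<close> and then at its conjugate gives, on the slice and therefore on \<open>\<Omega>\<close>,
  \<open>f q = f q\<^sub>0 + (q - q\<^sub>0) A\<^sub>1 + \<Delta> q * k q\<close>, where \<open>k = R\<^bsub>qcnj q\<^sub>0\<^esub> R\<^bsub>q\<^sub>0\<^esub> f\<close> and
  \<open>\<Delta> q = q\<^sup>2 - 2 (Re q\<^sub>0) q + |q\<^sub>0|\<^sup>2\<close> (\<open>R_op_quadratic_expansion\<close>). The product with \<open>\<Delta>\<close> can be
  taken pointwise on all of \<open>\<Omega>\<close> because \<open>\<Delta>\<close> has real coefficients. Along the line
  \<open>q\<^sub>0 + t v\<close> one has \<open>\<Delta> (q\<^sub>0 + t v) = t (q\<^sub>0 v - v qcnj q\<^sub>0) + t\<^sup>2 v\<^sup>2\<close>, so dividing by \<open>t\<close> and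
  using the continuity of \<open>k\<close> at \<open>q\<^sub>0\<close> yields the directional derivative, for every \<open>v\<close>. A partial
  derivative with respect to a basis is the directional derivative along a basis vector.
\<close>

section \<open>Imaginary units and slices\<close>

lemma imag_units_iff:
  "I \<in> imag_units \<longleftrightarrow> qRe I = 0 \<and> (qIm1 I)\<^sup>2 + (qIm2 I)\<^sup>2 + (qIm3 I)\<^sup>2 = 1"
proof
  assume "I \<in> imag_units"
  then have sq: "I * I = - 1" by (simp add: imag_units_def power2_eq_square)
  have re: "(qRe I)\<^sup>2 - (qIm1 I)\<^sup>2 - (qIm2 I)\<^sup>2 - (qIm3 I)\<^sup>2 = - 1"
    and im: "qRe I * qIm1 I = 0" "qRe I * qIm2 I = 0" "qRe I * qIm3 I = 0"
    using sq by (auto simp: quat_eq_iff power2_eq_square)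
  have "qRe I = 0"
  proof (rule ccontr)
    assume "qRe I \<noteq> 0"
    with im have "qIm1 I = 0" "qIm2 I = 0" "qIm3 I = 0" by auto
    with re have "(qRe I)\<^sup>2 = - 1" by simp
    then show False using zero_le_power2[of "qRe I"] by linarith
  qed
  with re show "qRe I = 0 \<and> (qIm1 I)\<^sup>2 + (qIm2 I)\<^sup>2 + (qIm3 I)\<^sup>2 = 1" by simp
next
  assume "qRe I = 0 \<and> (qIm1 I)\<^sup>2 + (qIm2 I)\<^sup>2 + (qIm3 I)\<^sup>2 = 1"
  then show "I \<in> imag_units"
    unfolding imag_units_def by (auto simp: quat_eq_iff power2_eq_square)
qed

lemma imag_units_square: "I \<in> imag_units \<Longrightarrow> I * I = - 1"
  by (simp add: imag_units_def power2_eq_square)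

lemma imag_units_square_left: "I \<in> imag_units \<Longrightarrow> I * (I * x) = - x"
  by (metis imag_units_square minus_mult_left mult.assoc mult_1)

lemma imag_units_norm: "I \<in> imag_units \<Longrightarrow> norm I = 1"
  by (simp add: imag_units_iff norm_quat_def)

lemma imag_units_uminus: "I \<in> imag_units \<Longrightarrow> - I \<in> imag_units"
  by (simp add: imag_units_def)

lemma imag_units_nonempty: "Quat 0 1 0 0 \<in> imag_units"
  by (simp add: imag_units_iff)

lemma imag_units_orthogonal_exists:
  assumes "I \<in> imag_units"
  shows "\<exists>J\<in>imag_units. inner I J = 0"
proof (cases "qIm1 I = 0 \<and> qIm2 I = 0")
  case True
  then have "inner I (Quat 0 1 0 0) = 0" by (simp add: inner_quat_def)
  then show ?thesis using imag_units_nonempty by blast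
next
  case False
  define r where "r = sqrt ((qIm1 I)\<^sup>2 + (qIm2 I)\<^sup>2)"
  have "(qIm1 I)\<^sup>2 + (qIm2 I)\<^sup>2 > 0"
    using False by (simp add: sum_power2_gt_zero_iff)
  then have r: "r\<^sup>2 = (qIm1 I)\<^sup>2 + (qIm2 I)\<^sup>2" "r \<noteq> 0" by (auto simp: r_def)
  define J where "J = Quat 0 (- qIm2 I / r) (qIm1 I / r) 0"
  have "(qIm2 I / r)\<^sup>2 + (qIm1 I / r)\<^sup>2 = 1"
    using r by (simp add: power_divide add.commute r_def flip: add_divide_distrib)
  then have "J \<in> imag_units" by (simp add: J_def imag_units_iff)
  moreover have "inner I J = 0" by (simp add: J_def inner_quat_def)
  ultimately show ?thesis by blast
qed

lemma imag_units_anticommute: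
  assumes "I \<in> imag_units" "J \<in> imag_units" "inner I J = 0"
  shows "J * I = - (I * J)"
  using assms by (simp add: imag_units_iff inner_quat_def quat_eq_iff algebra_simps)

lemma inner_imag_unit_mult:
  assumes "I \<in> imag_units"
  shows "inner (I * x) (I * y) = inner x y"
proof -
  have "norm (I * x + I * y) = norm (x + y)"
    using assms by (simp add: norm_mult imag_units_norm flip: distrib_left)
  then show ?thesis
    using assms by (simp add: dot_norm norm_mult imag_units_norm)
qed

lemma inner_imag_unit_mult_left:
  assumes "I \<in> imag_units"
  shows "inner (I * x) y = - inner x (I * y)"
  using inner_imag_unit_mult[OF assms, of "I * x" y] assms
  by (simp add: imag_units_square_left)

definition slice_emb :: "quat \<Rightarrow> complex \<Rightarrow> quat" where
  "slice_emb I z = of_real (Re z) + I * of_real (Im z)"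

lemma slice_emb_altdef: "slice_emb I z = Re z *\<^sub>R 1 + Im z *\<^sub>R I"
  by (simp add: slice_emb_def of_real_def)

lemma slice_emb_mult:
  "I \<in> imag_units \<Longrightarrow> slice_emb I (z * w) = slice_emb I z * slice_emb I w"
  by (simp add: slice_emb_altdef algebra_simps imag_units_square)

lemma slice_emb_add: "slice_emb I (z + w) = slice_emb I z + slice_emb I w"
  and slice_emb_diff: "slice_emb I (z - w) = slice_emb I z - slice_emb I w"
  and slice_emb_scaleR: "slice_emb I (r *\<^sub>R z) = r *\<^sub>R slice_emb I z"
  and slice_emb_1 [simp]: "slice_emb I 1 = 1"
  and slice_emb_0 [simp]: "slice_emb I 0 = 0"
  and slice_emb_of_real [simp]: "slice_emb I (of_real r) = of_real r"
  by (simp_all add: slice_emb_altdef algebra_simps of_real_def)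

lemma slice_emb_cnj: "slice_emb I (cnj z) = slice_emb (- I) z"
  by (simp add: slice_emb_altdef)

lemma qcnj_slice_emb: "I \<in> imag_units \<Longrightarrow> qcnj (slice_emb I z) = slice_emb I (cnj z)"
  by (simp add: slice_emb_altdef qcnj_def quat_eq_iff imag_units_iff)

lemma slice_emb_eq_0_iff:
  assumes "I \<in> imag_units"
  shows "slice_emb I z = 0 \<longleftrightarrow> z = 0"
proof
  assume *: "slice_emb I z = 0"
  have "Re z = 0"
    using arg_cong[OF *, of qRe] assms by (simp add: slice_emb_altdef imag_units_iff)
  moreover from this * have "Im z = 0"
    using imag_units_norm[OF assms] by (auto simp: slice_emb_altdef)
  ultimately show "z = 0" by (simp add: complex_eq_iff)
qed simp

lemma bounded_linear_slice_emb: "bounded_linear (slice_emb I)"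
  unfolding slice_emb_altdef
  by (intro bounded_linear_add bounded_linear_scaleR_left[THEN bounded_linear_compose]
      bounded_linear_Re bounded_linear_Im)

lemma continuous_on_slice_emb: "continuous_on S (slice_emb I)"
  by (rule bounded_linear.continuous_on[OF bounded_linear_slice_emb continuous_on_id])

lemma slice_eq_range: "slice I = range (slice_emb I)"
proof -
  have "of_real x + I * of_real y = slice_emb I (Complex x y)" for x y
    by (simp add: slice_emb_def)
  then have "slice I \<subseteq> range (slice_emb I)" by (auto simp: slice_def)
  then show ?thesis by (auto simp: slice_emb_def slice_def)
qed

lemma quat_in_slice:
  obtains I z where "I \<in> imag_units" "q = slice_emb I z"
proof -
  define v where "v = Quat 0 (qIm1 q) (qIm2 q) (qIm3 q)"
  have q: "q = of_real (qRe q) + v" by (simp add: v_def quat_eq_iff)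
  show ?thesis
  proof (cases "v = 0")
    case True
    with q show ?thesis
      using that[OF imag_units_nonempty, of "of_real (qRe q)"] by simp
  next
    case False
    then have n: "norm v > 0" "(norm v)\<^sup>2 = (qIm1 q)\<^sup>2 + (qIm2 q)\<^sup>2 + (qIm3 q)\<^sup>2"
      by (simp, simp add: norm_quat_def v_def)
    have "(inverse (norm v))\<^sup>2 * ((qIm1 q)\<^sup>2 + (qIm2 q)\<^sup>2 + (qIm3 q)\<^sup>2) = 1"
      unfolding n(2)[symmetric] using n(1) by (simp add: power_inverse)
    moreover have "qRe v = 0" "qIm1 v = qIm1 q" "qIm2 v = qIm2 q" "qIm3 v = qIm3 q"
      by (simp_all add: v_def)
    ultimately have "v /\<^sub>R norm v \<in> imag_units"
      by (simp add: imag_units_iff power_mult_distrib distrib_left)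
    moreover have "q = slice_emb (v /\<^sub>R norm v) (Complex (qRe q) (norm v))"
      using n q by (simp add: slice_emb_altdef of_real_def)
    ultimately show ?thesis using that by blast
  qed
qed

lemma commuting_imp_in_slice:
  assumes I: "I \<in> imag_units" and comm: "w * I = I * w"
  shows "w \<in> slice I"
proof -
  define c where "c = inner w I"
  have I0: "qRe I = 0" and n: "qIm1 I * qIm1 I + qIm2 I * qIm2 I + qIm3 I * qIm3 I = 1"
    using I by (auto simp: imag_units_iff power2_eq_square)
  have c: "c = qIm1 w * qIm1 I + qIm2 w * qIm2 I + qIm3 w * qIm3 I"
    by (simp add: c_def inner_quat_def I0)
  have x: "qIm2 w * qIm3 I = qIm3 w * qIm2 I" "qIm3 w * qIm1 I = qIm1 w * qIm3 I"
      "qIm1 w * qIm2 I = qIm2 w * qIm1 I"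
    using comm I0 by (auto simp: quat_eq_iff algebra_simps)
  have "qIm1 w = c * qIm1 I" "qIm2 w = c * qIm2 I" "qIm3 w = c * qIm3 I"
    using x n unfolding c by algebra+
  then have "w = slice_emb I (Complex (qRe w) c)"
    by (simp add: slice_emb_altdef quat_eq_iff I0)
  then show ?thesis unfolding slice_eq_range by blast
qed

section \<open>Holomorphy on a slice in terms of a complex variable\<close>

text \<open>
  The real derivative of \<open>\<phi>\<close> is left multiplication of a fixed quaternion by the increment. This is
  the Cauchy-Riemann equation for left multiplication by \<open>I\<close> in a form that is stable under sums
  and under products with constants on the right.
\<close>

definition slice_hol :: "quat \<Rightarrow> complex set \<Rightarrow> (complex \<Rightarrow> quat) \<Rightarrow> bool" where
  "slice_hol I D \<phi> \<longleftrightarrow> (\<forall>z\<in>D. \<exists>d. (\<phi> has_derivative (\<lambda>h. slice_emb I h * d)) (at z))"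

lemma holomorphic_on_slice_iff:
  assumes I: "I \<in> imag_units"
  shows "holomorphic_on_slice I (\<Omega> \<inter> slice I) f \<longleftrightarrow>
         slice_hol I (slice_emb I -` \<Omega>) (\<lambda>z. f (slice_emb I z))"
proof
  assume hol: "holomorphic_on_slice I (\<Omega> \<inter> slice I) f"
  show "slice_hol I (slice_emb I -` \<Omega>) (\<lambda>z. f (slice_emb I z))"
    unfolding slice_hol_def
  proof
    fix z assume "z \<in> slice_emb I -` \<Omega>"
    then have "of_real (Re z) + I * of_real (Im z) \<in> \<Omega> \<inter> slice I"
      by (auto simp: slice_emb_def slice_def)
    then obtain D where D: "((\<lambda>(s, t). f (of_real s + I * of_real t)) has_derivative D) (at (Re z, Im z))"
      and "(1 / 2) *\<^sub>R (D (1, 0) + I * D (0, 1)) = 0"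
      using hol unfolding holomorphic_on_slice_def by blast
    then have "I * (D (1, 0) + I * D (0, 1)) = 0" by simp
    then have CR: "D (0, 1) = I * D (1, 0)"
      by (simp add: distrib_left imag_units_square_left[OF I])
    have lin: "D (a, b) = a *\<^sub>R D (1, 0) + b *\<^sub>R D (0, 1)" for a b
      using has_derivative_linear[OF D]
        linear_add[of D "a *\<^sub>R (1, 0)" "b *\<^sub>R (0, 1)"]
      by (simp add: linear_scale[OF has_derivative_linear[OF D], symmetric])
    have "((\<lambda>z. (Re z, Im z)) has_derivative (\<lambda>h. (Re h, Im h))) (at z)"
      by (auto intro!: derivative_eq_intros)
    from diff_chain_at[OF this D]
    have "((\<lambda>z. f (slice_emb I z)) has_derivative (\<lambda>h. D (Re h, Im h))) (at z)"
      by (simp add: o_def slice_emb_def)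
    moreover have "(\<lambda>h. D (Re h, Im h)) = (\<lambda>h. slice_emb I h * D (1, 0))"
      by (subst lin) (simp add: CR slice_emb_altdef distrib_right)
    ultimately show "\<exists>d. ((\<lambda>z. f (slice_emb I z)) has_derivative (\<lambda>h. slice_emb I h * d)) (at z)"
      by auto
  qed
next
  assume hol: "slice_hol I (slice_emb I -` \<Omega>) (\<lambda>z. f (slice_emb I z))"
  show "holomorphic_on_slice I (\<Omega> \<inter> slice I) f"
    unfolding holomorphic_on_slice_def
  proof (intro allI impI)
    fix x y assume "of_real x + I * of_real y \<in> \<Omega> \<inter> slice I"
    then have "Complex x y \<in> slice_emb I -` \<Omega>" by (simp add: slice_emb_def)
    then obtain d where d: "((\<lambda>z. f (slice_emb I z)) has_derivative (\<lambda>h. slice_emb I h * d))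
        (at (Complex x y))"
      using hol unfolding slice_hol_def by blast
    have c: "Complex s t = of_real s + \<i> * of_real t" for s t
      by (simp add: complex_eq_iff)
    have "((\<lambda>p. Complex (fst p) (snd p)) has_derivative (\<lambda>p. Complex (fst p) (snd p))) (at (x, y))"
      unfolding c by (auto intro!: derivative_eq_intros)
    then have "((\<lambda>z. f (slice_emb I z)) \<circ> (\<lambda>p. Complex (fst p) (snd p)) has_derivative
        (\<lambda>h. slice_emb I h * d) \<circ> (\<lambda>p. Complex (fst p) (snd p))) (at (x, y))"
      by (rule diff_chain_at) (simp add: d)
    then have "((\<lambda>(s, t). f (of_real s + I * of_real t)) has_derivative
        (\<lambda>p. slice_emb I (Complex (fst p) (snd p)) * d)) (at (x, y))"
      by (simp add: o_def slice_emb_def case_prod_unfold)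
    moreover have "(1 / 2) *\<^sub>R (slice_emb I (Complex 1 0) * d + I * (slice_emb I (Complex 0 1) * d)) = 0"
      by (simp add: slice_emb_altdef imag_units_square_left[OF I])
    ultimately show "\<exists>D. ((\<lambda>(s, t). f (of_real s + I * of_real t)) has_derivative D) (at (x, y)) \<and>
        (1 / 2) *\<^sub>R (D (1, 0) + I * D (0, 1)) = 0"
      by (metis (no_types, lifting) fst_conv snd_conv)
  qed
qed

lemma slice_hol_add:
  assumes "slice_hol I D \<phi>" "slice_hol I D \<psi>"
  shows "slice_hol I D (\<lambda>z. \<phi> z + \<psi> z)"
  unfolding slice_hol_def
proof
  fix z assume "z \<in> D"
  with assms obtain d e where
    "(\<phi> has_derivative (\<lambda>h. slice_emb I h * d)) (at z)"
    "(\<psi> has_derivative (\<lambda>h. slice_emb I h * e)) (at z)"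
    unfolding slice_hol_def by blast
  from has_derivative_add[OF this]
  show "\<exists>d. ((\<lambda>z. \<phi> z + \<psi> z) has_derivative (\<lambda>h. slice_emb I h * d)) (at z)"
    by (auto simp flip: distrib_left)
qed

lemma slice_hol_mult_right:
  assumes "slice_hol I D \<phi>"
  shows "slice_hol I D (\<lambda>z. \<phi> z * c)"
  unfolding slice_hol_def
proof
  fix z assume "z \<in> D"
  with assms obtain d where "(\<phi> has_derivative (\<lambda>h. slice_emb I h * d)) (at z)"
    unfolding slice_hol_def by blast
  from has_derivative_mult_left[OF this, of c]
  show "\<exists>d. ((\<lambda>z. \<phi> z * c) has_derivative (\<lambda>h. slice_emb I h * d)) (at z)"
    by (auto simp: mult.assoc)
qed

lemma slice_emb_commute: "slice_emb I z * I = I * slice_emb I z"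
  by (simp add: slice_emb_altdef algebra_simps)

lemma slice_hol_mult_unit_left:
  assumes "slice_hol I D \<phi>"
  shows "slice_hol I D (\<lambda>z. I * \<phi> z)"
  unfolding slice_hol_def
proof
  fix z assume "z \<in> D"
  with assms obtain d where "(\<phi> has_derivative (\<lambda>h. slice_emb I h * d)) (at z)"
    unfolding slice_hol_def by blast
  from has_derivative_mult_right[OF this, of I]
  have "((\<lambda>z. I * \<phi> z) has_derivative (\<lambda>h. slice_emb I h * (I * d))) (at z)"
    by (simp flip: mult.assoc add: slice_emb_commute)
  then show "\<exists>d. ((\<lambda>z. I * \<phi> z) has_derivative (\<lambda>h. slice_emb I h * d)) (at z)"
    by blast
qed

lemma slice_hol_mult_emb_left:
  assumes I: "I \<in> imag_units" and "slice_hol I D \<phi>"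
  shows "slice_hol I D (\<lambda>z. slice_emb I (z - a) * \<phi> z)"
  unfolding slice_hol_def
proof
  fix z assume "z \<in> D"
  with assms obtain d where d: "(\<phi> has_derivative (\<lambda>h. slice_emb I h * d)) (at z)"
    unfolding slice_hol_def by blast
  have "((\<lambda>z. slice_emb I (z - a)) has_derivative slice_emb I) (at z)"
    by (rule bounded_linear.has_derivative[OF bounded_linear_slice_emb])
       (auto intro!: derivative_eq_intros)
  from has_derivative_mult[OF this d]
  have "((\<lambda>z. slice_emb I (z - a) * \<phi> z) has_derivative
      (\<lambda>h. slice_emb I h * (slice_emb I (z - a) * d + \<phi> z))) (at z)"
    by (simp flip: mult.assoc slice_emb_mult[OF I] add: distrib_left mult.commute[of "z - a"])
  then show "\<exists>d. ((\<lambda>z. slice_emb I (z - a) * \<phi> z) has_derivative (\<lambda>h. slice_emb I h * d)) (at z)"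
    by blast
qed

lemma slice_hol_const: "slice_hol I D (\<lambda>z. c)"
  unfolding slice_hol_def by (auto intro!: exI[of _ 0] derivative_eq_intros)

lemma slice_hol_emb: "slice_hol I D (slice_emb I)"
  unfolding slice_hol_def
  using bounded_linear_imp_has_derivative[OF bounded_linear_slice_emb, of I]
  by (auto intro!: exI[of _ 1])

lemma slice_hol_cong:
  assumes "open D" "slice_hol I D \<phi>" "\<And>z. z \<in> D \<Longrightarrow> \<phi> z = \<psi> z"
  shows "slice_hol I D \<psi>"
  using assms unfolding slice_hol_def by (meson has_derivative_transform_within_open)

lemma slice_hol_isCont: "slice_hol I D \<phi> \<Longrightarrow> z \<in> D \<Longrightarrow> isCont \<phi> z"
  unfolding slice_hol_def by (meson has_derivative_continuous)

text \<open>
  To use complex analysis, quaternion-valued functions on a slice are tested against functionals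
  that are complex linear for left multiplication by \<open>I\<close>: since left multiplication by \<open>I\<close> is
  orthogonal and squares to \<open>- 1\<close>, it is skew-adjoint, and the pair of inner products with \<open>w\<close> and
  \<open>I * w\<close> is such a functional. As \<open>w\<close> varies these functionals separate points.
\<close>

definition slice_coord :: "quat \<Rightarrow> quat \<Rightarrow> quat \<Rightarrow> complex" where
  "slice_coord I w q = Complex (inner q w) (inner q (I * w))"

lemma slice_coord_altdef:
  "slice_coord I w q = of_real (inner q w) + \<i> * of_real (inner q (I * w))"
  by (simp add: slice_coord_def complex_eq_iff)

lemma bounded_linear_slice_coord: "bounded_linear (slice_coord I w)"
  unfolding slice_coord_altdef
  by (intro bounded_linear_add bounded_linear_const_mult
      bounded_linear_of_real[THEN bounded_linear_compose] bounded_linear_inner_left)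

lemma slice_coord_mult:
  assumes "I \<in> imag_units"
  shows "slice_coord I w (slice_emb I z * q) = z * slice_coord I w q"
  by (simp add: slice_coord_def slice_emb_altdef distrib_right inner_add_left
      inner_imag_unit_mult[OF assms] inner_imag_unit_mult_left[OF assms]
      imag_units_square_left[OF assms] complex_eq_iff)

lemma slice_coord_eqI:
  assumes "\<And>w. slice_coord I w p = slice_coord I w q"
  shows "p = q"
proof -
  have "inner p w = inner q w" for w
    using assms[of w] by (simp add: slice_coord_def)
  then show ?thesis using vector_eq_rdot by blast
qed

lemma slice_coord_diff: "slice_coord I w (p - q) = slice_coord I w p - slice_coord I w q"
  by (simp add: linear_diff bounded_linear.linear bounded_linear_slice_coord)

lemma slice_hol_imp_coord_derivative:
  assumes I: "I \<in> imag_units" and d: "(\<phi> has_derivative (\<lambda>h. slice_emb I h * d)) (at z)"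
  shows "((\<lambda>z. slice_coord I w (\<phi> z)) has_field_derivative slice_coord I w d) (at z)"
  using bounded_linear.has_derivative[OF bounded_linear_slice_coord d, of I w]
  unfolding has_field_derivative_def slice_coord_mult[OF I]
  by (simp add: mult_commute_abs)

text \<open>
  For the converse, the coordinates with respect to an orthonormal basis are real parts of such
  functionals, so \<open>\<phi>\<close> has some real derivative \<open>L\<close>. Every functional applied to \<open>L\<close> is complex
  linear, so \<open>L\<close> commutes with left multiplication by \<open>I\<close> and is determined by \<open>L 1\<close>.
\<close>

lemma slice_hol_iff_coord_holomorphic:
  assumes I: "I \<in> imag_units" and "open D"
  shows "slice_hol I D \<phi> \<longleftrightarrow> (\<forall>w. (\<lambda>z. slice_coord I w (\<phi> z)) holomorphic_on D)"
proof
  assume "slice_hol I D \<phi>"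
  then show "\<forall>w. (\<lambda>z. slice_coord I w (\<phi> z)) holomorphic_on D"
    unfolding slice_hol_def holomorphic_on_open[OF \<open>open D\<close>]
    using slice_hol_imp_coord_derivative[OF I] by blast
next
  assume hol: "\<forall>w. (\<lambda>z. slice_coord I w (\<phi> z)) holomorphic_on D"
  show "slice_hol I D \<phi>"
    unfolding slice_hol_def
  proof
    fix z assume "z \<in> D"
    then have "\<forall>w. \<exists>c. ((\<lambda>z. slice_coord I w (\<phi> z)) has_field_derivative c) (at z)"
      using hol holomorphic_on_open[OF \<open>open D\<close>] by blast
    then obtain c where c: "\<And>w. ((\<lambda>z. slice_coord I w (\<phi> z)) has_derivative (*) (c w)) (at z)"
      unfolding has_field_derivative_def by metis
    define L where "L h = (\<Sum>w\<in>Basis. Re (c w * h) *\<^sub>R w)" for h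
    have "((\<lambda>z. inner (\<phi> z) w) has_derivative (\<lambda>h. inner (L h) w)) (at z)" if "w \<in> Basis" for w
      using has_derivative_Re[OF c[of w]] that
      by (simp add: slice_coord_def L_def)
    then have L: "(\<phi> has_derivative L) (at z)"
      by (subst has_derivative_componentwise_within) simp
    have cL: "slice_coord I w (L h) = c w * h" for w h
      using has_derivative_unique[OF bounded_linear.has_derivative[OF bounded_linear_slice_coord L] c[of w]]
      by metis
    have "L h = slice_emb I h * L 1" for h
      by (rule slice_coord_eqI[of I]) (simp add: slice_coord_mult[OF I] cL)
    then have "L = (\<lambda>h. slice_emb I h * L 1)" by blast
    with L show "\<exists>d. (\<phi> has_derivative (\<lambda>h. slice_emb I h * d)) (at z)" by metis
  qed
qed

text \<open>
  Under every functional the quotient of \<open>\<phi> z - \<phi> a\<close> by \<open>z - a\<close> becomes a complex difference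
  quotient, whose singularity at \<open>a\<close> is removable.
\<close>

lemma slice_hol_divided_difference:
  assumes I: "I \<in> imag_units" and D: "open D" and "a \<in> D" and hol: "slice_hol I D \<phi>"
  obtains \<psi> where "slice_hol I D \<psi>" "\<And>z. \<phi> z = \<phi> a + slice_emb I (z - a) * \<psi> z"
proof -
  obtain d where d: "(\<phi> has_derivative (\<lambda>h. slice_emb I h * d)) (at a)"
    using hol \<open>a \<in> D\<close> unfolding slice_hol_def by blast
  define \<psi> where "\<psi> z = (if z = a then d else inverse (slice_emb I (z - a)) * (\<phi> z - \<phi> a))" for z
  have \<psi>: "\<phi> z = \<phi> a + slice_emb I (z - a) * \<psi> z" for z
    by (cases "z = a") (simp_all add: \<psi>_def slice_emb_eq_0_iff[OF I] flip: mult.assoc)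
  have "(\<lambda>z. slice_coord I w (\<psi> z)) holomorphic_on D" for w
  proof -
    let ?c = "\<lambda>z. slice_coord I w (\<phi> z)"
    have "slice_coord I w (\<psi> z) = (if z = a then deriv ?c a else (?c z - ?c a) / (z - a))" for z
    proof (cases "z = a")
      case True
      then show ?thesis
        using DERIV_imp_deriv[OF slice_hol_imp_coord_derivative[OF I d, of w]] by (simp add: \<psi>_def)
    next
      case False
      have "\<phi> z - \<phi> a = slice_emb I (z - a) * \<psi> z" using \<psi>[of z] by simp
      then have "?c z - ?c a = (z - a) * slice_coord I w (\<psi> z)"
        by (metis slice_coord_diff slice_coord_mult[OF I])
      with False show ?thesis by simp
    qed
    moreover have "(\<lambda>z. if z = a then deriv ?c a else (?c z - ?c a) / (z - a)) holomorphic_on D"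
      using hol slice_hol_iff_coord_holomorphic[OF I D] D by (intro pole_lemma_open) auto
    ultimately show ?thesis by simp
  qed
  then have "slice_hol I D \<psi>" using slice_hol_iff_coord_holomorphic[OF I D] by blast
  with \<psi> that show ?thesis by blast
qed

text \<open>
  The complex identity theorem under each functional; the real points of \<open>D\<close> accumulate at \<open>r\<close>
  because \<open>D\<close> is open.
\<close>

lemma slice_hol_identity_on_reals:
  assumes I: "I \<in> imag_units" and D: "open D" "connected D" and r: "of_real r \<in> D"
    and hol: "slice_hol I D \<phi>" "slice_hol I D \<psi>"
    and eq: "\<And>x. of_real x \<in> D \<Longrightarrow> \<phi> (of_real x) = \<psi> (of_real x)"
    and z: "z \<in> D"
  shows "\<phi> z = \<psi> z"
proof (rule slice_coord_eqI)
  fix w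
  let ?c = "\<lambda>z. slice_coord I w (\<phi> z) - slice_coord I w (\<psi> z)"
  have "complex_of_real r islimpt D \<inter> \<real>"
    unfolding islimpt_approachable
  proof (intro allI impI)
    fix e :: real assume "e > 0"
    obtain e' where e': "e' > 0" "ball (complex_of_real r) e' \<subseteq> D"
      using D(1) r by (meson openE)
    define s where "s = min e e' / 2"
    have s: "s > 0" "s < e" "s < e'" using \<open>e > 0\<close> e' by (auto simp: s_def min_def)
    have dist: "dist (complex_of_real (r + s)) (of_real r) = s"
      using s(1) by (simp add: dist_norm)
    then have "of_real (r + s) \<in> D \<inter> \<real>" using e' s by (auto simp: dist_commute)
    with dist s show "\<exists>x'\<in>D \<inter> \<real>. x' \<noteq> complex_of_real r \<and> dist x' (of_real r) < e"
      by (intro bexI[of _ "of_real (r + s)"]) (auto simp del: of_real_add)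
  qed
  moreover have "?c holomorphic_on D"
    using hol slice_hol_iff_coord_holomorphic[OF I D(1)] by (intro holomorphic_on_diff) auto
  moreover have "?c x = 0" if "x \<in> D \<inter> \<real>" for x
    using that eq by (auto elim: Reals_cases)
  ultimately have "?c z = 0"
    by (intro analytic_continuation[OF _ D _ r _ _ z, where f = ?c and U = "D \<inter> \<real>"]) blast+
  then show "slice_coord I w (\<phi> z) = slice_coord I w (\<psi> z)" by simp
qed


section \<open>The representation formula\<close>

definition quat_vec :: "quat \<Rightarrow> quat" where
  "quat_vec q = q - of_real (qRe q)"

text \<open>
  The extension of a function from the slice \<open>L\<^sub>I\<close> to all slices, that is, the right-hand side of the
  representation formula. Each \<open>q\<close> is written as \<open>x + J y\<close> with \<open>y \<ge> 0\<close>; at real points, where \<open>J\<close>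
  is not determined, \<open>sgn 0 = 0\<close> does no harm since the difference it multiplies vanishes there.
\<close>

definition slice_ext :: "quat \<Rightarrow> (complex \<Rightarrow> quat) \<Rightarrow> quat \<Rightarrow> quat" where
  "slice_ext I \<phi> q = (let z = Complex (qRe q) (norm (quat_vec q)) in
     (1 / 2) *\<^sub>R (\<phi> z + \<phi> (cnj z) - sgn (quat_vec q) * I * (\<phi> z - \<phi> (cnj z))))"

lemma qRe_slice_emb: "J \<in> imag_units \<Longrightarrow> qRe (slice_emb J z) = Re z"
  by (simp add: slice_emb_altdef imag_units_iff)

lemma quat_vec_slice_emb: "J \<in> imag_units \<Longrightarrow> quat_vec (slice_emb J z) = Im z *\<^sub>R J"
  by (simp add: quat_vec_def qRe_slice_emb) (simp add: slice_emb_altdef of_real_def)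

text \<open>
  Replacing \<open>(J, y)\<close> by \<open>(- J, - y)\<close> does not change the extension, so the formula holds for either
  sign of the imaginary part.
\<close>

lemma slice_ext_slice_emb:
  assumes J: "J \<in> imag_units"
  shows "slice_ext I \<phi> (slice_emb J z) =
    (1 / 2) *\<^sub>R (\<phi> z + \<phi> (cnj z) - J * I * (\<phi> z - \<phi> (cnj z)))"
proof -
  have J1: "norm J = 1" "sgn J = J" using imag_units_norm[OF J] by (auto simp: sgn_div_norm)
  consider "Im z > 0" | "Im z = 0" | "Im z < 0" by linarith
  then show ?thesis
  proof cases
    case 1
    then have "Complex (Re z) \<bar>Im z\<bar> = z" by (simp add: complex_eq_iff)
    then show ?thesis
      using 1 by (simp add: slice_ext_def qRe_slice_emb[OF J] quat_vec_slice_emb[OF J] J1 sgn_scaleR)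
  next
    case 2
    then have "Complex (Re z) \<bar>Im z\<bar> = z" "cnj z = z" by (auto simp: complex_eq_iff)
    then show ?thesis
      using 2 by (simp add: slice_ext_def qRe_slice_emb[OF J] quat_vec_slice_emb[OF J] J1 sgn_scaleR)
  next
    case 3
    then have "Complex (Re z) \<bar>Im z\<bar> = cnj z" by (simp add: complex_eq_iff)
    moreover have "sgn (Im z *\<^sub>R J) = - J" using 3 by (simp add: sgn_scaleR J1)
    moreover have "- J * I * (\<phi> (cnj z) - \<phi> z) = J * I * (\<phi> z - \<phi> (cnj z))"
      by (simp add: right_diff_distrib)
    ultimately show ?thesis
      unfolding slice_ext_def Let_def qRe_slice_emb[OF J] quat_vec_slice_emb[OF J] norm_scaleR J1
      by (simp only: mult_1_right complex_cnj_cnj add.commute)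
  qed
qed

lemma slice_ext_same_slice:
  "I \<in> imag_units \<Longrightarrow> slice_ext I \<phi> (slice_emb I z) = \<phi> z"
  by (simp add: slice_ext_slice_emb imag_units_square algebra_simps flip: scaleR_2)

lemma symmetric_set_slice_emb:
  assumes "symmetric_set \<Omega>" "I \<in> imag_units" "J \<in> imag_units" "slice_emb I z \<in> \<Omega>"
  shows "slice_emb J z \<in> \<Omega>"
proof -
  have "of_real (Re z) + of_real (Im z) * J \<in> \<Omega>"
    using assms(1)[unfolded symmetric_set_def, rule_format, OF assms(2), of "Re z" "Im z" J]
      assms(3,4) by (simp add: slice_emb_def)
  then show ?thesis by (simp add: slice_emb_def of_real_def)
qed

lemma symmetric_set_slice_emb_cnj:
  assumes "symmetric_set \<Omega>" "I \<in> imag_units" "slice_emb I z \<in> \<Omega>"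
  shows "slice_emb I (cnj z) \<in> \<Omega>"
  using symmetric_set_slice_emb[OF assms(1,2) imag_units_uminus assms(3)] assms(2)
  by (simp add: slice_emb_cnj)

lemma slice_regular_on_iff:
  "slice_regular_on \<Omega> f \<longleftrightarrow>
     (\<forall>I\<in>imag_units. slice_hol I (slice_emb I -` \<Omega>) (\<lambda>z. f (slice_emb I z)))"
  unfolding slice_regular_on_def using holomorphic_on_slice_iff by blast

lemma open_vimage_slice_emb: "open \<Omega> \<Longrightarrow> open (slice_emb I -` \<Omega>)"
  by (rule open_vimage[OF _ continuous_on_slice_emb])

lemma slice_regular_on_cong:
  assumes "open \<Omega>" "slice_regular_on \<Omega> f" "\<And>q. q \<in> \<Omega> \<Longrightarrow> f q = g q"
  shows "slice_regular_on \<Omega> g"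
  using assms unfolding slice_regular_on_iff
  by (meson open_vimage_slice_emb slice_hol_cong vimageD)

text \<open>
  The point is that \<open>1 - J * I\<close> intertwines left multiplication by \<open>I\<close> with left multiplication by
  \<open>J\<close>, while \<open>1 + J * I\<close> intertwines \<open>- I\<close> with \<open>J\<close> and thereby compensates for the conjugation in
  the second summand.
\<close>

lemma slice_regular_on_slice_ext:
  assumes sym: "symmetric_set \<Omega>" and I: "I \<in> imag_units"
    and hol: "slice_hol I (slice_emb I -` \<Omega>) \<phi>"
  shows "slice_regular_on \<Omega> (slice_ext I \<phi>)"
  unfolding slice_regular_on_iff slice_hol_def
proof (intro ballI)
  fix J z assume J: "J \<in> imag_units" and z: "z \<in> slice_emb J -` \<Omega>"
  then have "slice_emb I z \<in> \<Omega>" "slice_emb I (cnj z) \<in> \<Omega>"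
    using symmetric_set_slice_emb[OF sym J I] symmetric_set_slice_emb_cnj[OF sym I] by auto
  then obtain d e where d: "(\<phi> has_derivative (\<lambda>h. slice_emb I h * d)) (at z)"
    and e: "(\<phi> has_derivative (\<lambda>h. slice_emb I h * e)) (at (cnj z))"
    using hol unfolding slice_hol_def by (meson vimageI2)
  have "(cnj has_derivative cnj) (at z)"
    by (rule bounded_linear_imp_has_derivative[OF bounded_linear_cnj])
  from diff_chain_at[OF this e]
  have e': "((\<lambda>z. \<phi> (cnj z)) has_derivative (\<lambda>h. slice_emb I (cnj h) * e)) (at z)"
    by (simp add: o_def)
  have "((\<lambda>z. slice_ext I \<phi> (slice_emb J z)) has_derivative
     (\<lambda>h. (1 / 2) *\<^sub>R (slice_emb I h * d + slice_emb I (cnj h) * e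
        - J * I * (slice_emb I h * d - slice_emb I (cnj h) * e)))) (at z)"
    unfolding slice_ext_slice_emb[OF J]
    by (intro has_derivative_scaleR_right has_derivative_diff has_derivative_add
        has_derivative_mult_right d e')
  moreover have "(1 / 2) *\<^sub>R (slice_emb I h * d + slice_emb I (cnj h) * e
        - J * I * (slice_emb I h * d - slice_emb I (cnj h) * e))
     = slice_emb J h * ((1 / 2) *\<^sub>R ((1 - J * I) * d + (1 + J * I) * e))" for h
    by (simp add: slice_emb_altdef algebra_simps imag_units_square[OF I] imag_units_square[OF J]
        imag_units_square_left[OF I] imag_units_square_left[OF J])
  ultimately show "\<exists>d. ((\<lambda>z. slice_ext I \<phi> (slice_emb J z)) has_derivative
      (\<lambda>h. slice_emb J h * d)) (at z)"
    by (simp only:) blast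
qed

definition slice_function :: "quat set \<Rightarrow> (quat \<Rightarrow> quat) \<Rightarrow> bool" where
  "slice_function \<Omega> f \<longleftrightarrow>
     (\<exists>a b. \<forall>J\<in>imag_units. \<forall>z. slice_emb J z \<in> \<Omega> \<longrightarrow> f (slice_emb J z) = a z + J * b z)"

lemma slice_functionI:
  assumes "\<And>J z. J \<in> imag_units \<Longrightarrow> slice_emb J z \<in> \<Omega> \<Longrightarrow> f (slice_emb J z) = a z + J * b z"
  shows "slice_function \<Omega> f"
  using assms unfolding slice_function_def by blast

lemma slice_functionE:
  assumes "slice_function \<Omega> f"
  obtains a b where
    "\<And>J z. J \<in> imag_units \<Longrightarrow> slice_emb J z \<in> \<Omega> \<Longrightarrow> f (slice_emb J z) = a z + J * b z"
  using assms unfolding slice_function_def by blast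

text \<open>
  A slice contains the points for both units \<open>I\<close> and \<open>- I\<close>, and the two equations obtained from
  them determine \<open>a\<close> and \<open>b\<close>.
\<close>

lemma slice_function_eqI:
  assumes sym: "symmetric_set \<Omega>" and f: "slice_function \<Omega> f" and g: "slice_function \<Omega> g"
    and I: "I \<in> imag_units"
    and eq: "\<And>z. slice_emb I z \<in> \<Omega> \<Longrightarrow> f (slice_emb I z) = g (slice_emb I z)"
    and q: "q \<in> \<Omega>"
  shows "f q = g q"
proof -
  obtain a b where ab: "\<And>J z. J \<in> imag_units \<Longrightarrow> slice_emb J z \<in> \<Omega> \<Longrightarrow> f (slice_emb J z) = a z + J * b z"
    using slice_functionE[OF f] by blast
  obtain c d where cd: "\<And>J z. J \<in> imag_units \<Longrightarrow> slice_emb J z \<in> \<Omega> \<Longrightarrow> g (slice_emb J z) = c z + J * d z"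
    using slice_functionE[OF g] by blast
  obtain J z where J: "J \<in> imag_units" and qz: "q = slice_emb J z" using quat_in_slice by blast
  have z: "slice_emb I z \<in> \<Omega>" "slice_emb (- I) z \<in> \<Omega>"
    using symmetric_set_slice_emb[OF sym J] I imag_units_uminus q qz by auto
  have 1: "a z + I * b z = c z + I * d z"
    using eq[OF z(1)] ab[OF I z(1)] cd[OF I z(1)] by simp
  have "f (slice_emb (- I) z) = g (slice_emb (- I) z)"
    using eq[of "cnj z"] z(2) by (simp add: slice_emb_cnj)
  then have 2: "a z - I * b z = c z - I * d z"
    using ab[OF imag_units_uminus[OF I] z(2)] cd[OF imag_units_uminus[OF I] z(2)] by simp
  have "2 *\<^sub>R a z = (a z + I * b z) + (a z - I * b z)" by (simp add: scaleR_2)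
  also have "\<dots> = 2 *\<^sub>R c z" by (simp only: 1 2) (simp add: scaleR_2)
  finally have a: "a z = c z" by simp
  with 1 have "I * (b z - d z) = 0" by (simp add: right_diff_distrib)
  moreover have "I \<noteq> 0" using imag_units_norm[OF I] by auto
  ultimately have "b z = d z" by simp
  with a show ?thesis using ab[OF J] cd[OF J] q qz by simp
qed

lemma slice_function_slice_ext: "slice_function \<Omega> (slice_ext I \<phi>)"
  by (rule slice_functionI[of _ _ "\<lambda>z. (1 / 2) *\<^sub>R (\<phi> z + \<phi> (cnj z))"
        "\<lambda>z. - ((1 / 2) *\<^sub>R (I * (\<phi> z - \<phi> (cnj z))))"])
     (simp add: slice_ext_slice_emb algebra_simps)

lemma connected_vimage_slice_emb:
  assumes "slice_domain \<Omega>" and J: "J \<in> imag_units"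
  shows "connected (slice_emb J -` \<Omega>)"
proof -
  define p where "p q = Complex (inner q 1) (inner q J)" for q
  have J1: "inner J J = 1" "inner 1 J = 0" "inner J 1 = 0"
    using imag_units_norm[OF J] J by (auto simp: dot_square_norm inner_quat_def imag_units_iff)
  have p: "p (slice_emb J z) = z" for z
    by (simp add: p_def slice_emb_altdef inner_add_left J1 complex_eq_iff) (simp add: inner_quat_def)
  have "slice_emb J -` \<Omega> = p ` (\<Omega> \<inter> slice J)"
  proof (intro equalityI subsetI)
    fix z assume "z \<in> slice_emb J -` \<Omega>"
    then have "slice_emb J z \<in> \<Omega> \<inter> slice J" by (auto simp: slice_eq_range)
    then show "z \<in> p ` (\<Omega> \<inter> slice J)" using p by (metis imageI)
  qed (auto simp: slice_eq_range p)
  moreover have "continuous_on A p" for A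
    unfolding p_def Complex_eq by (intro continuous_intros)
  ultimately show ?thesis
    using assms by (metis connected_continuous_image slice_domain_def)
qed

text \<open>
  Both sides are regular and they agree at the real points of \<open>\<Omega>\<close>, hence on every slice by the
  identity theorem.
\<close>

theorem representation_formula:
  assumes dom: "slice_domain \<Omega>" and sym: "symmetric_set \<Omega>" and f: "slice_regular_on \<Omega> f"
    and I: "I \<in> imag_units" and q: "q \<in> \<Omega>"
  shows "f q = slice_ext I (\<lambda>z. f (slice_emb I z)) q"
proof -
  let ?e = "slice_ext I (\<lambda>z. f (slice_emb I z))"
  obtain J z where J: "J \<in> imag_units" and qz: "q = slice_emb J z" using quat_in_slice by blast
  have "open \<Omega>" using dom by (simp add: slice_domain_def)
  obtain r where r: "of_real r \<in> \<Omega>"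
    using dom by (auto simp: slice_domain_def Reals_def)
  have "slice_regular_on \<Omega> ?e"
    using f I by (intro slice_regular_on_slice_ext[OF sym]) (auto simp: slice_regular_on_iff)
  then have hol: "slice_hol J (slice_emb J -` \<Omega>) (\<lambda>z. f (slice_emb J z))"
    "slice_hol J (slice_emb J -` \<Omega>) (\<lambda>z. ?e (slice_emb J z))"
    using f J unfolding slice_regular_on_iff by blast+
  have "?e (slice_emb J (of_real x)) = f (slice_emb J (of_real x))" for x
    unfolding slice_ext_slice_emb[OF J] by (simp flip: scaleR_2)
  then have "f (slice_emb J z) = ?e (slice_emb J z)"
    using slice_hol_identity_on_reals[OF J open_vimage_slice_emb[OF \<open>open \<Omega>\<close>]
        connected_vimage_slice_emb[OF dom J] _ hol, of r z] q qz r by simp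
  then show ?thesis by (simp add: qz)
qed

lemma slice_regular_imp_slice_function:
  assumes "slice_domain \<Omega>" "symmetric_set \<Omega>" "slice_regular_on \<Omega> f"
  shows "slice_function \<Omega> f"
  using slice_function_slice_ext[of \<Omega>] representation_formula[OF assms imag_units_nonempty]
  unfolding slice_function_def by metis

text \<open>
  Regularity only gives continuity inside each slice. Continuity on \<open>\<Omega>\<close> comes from the
  representation formula: away from the real axis the unit \<open>J\<close> depends continuously on the point,
  and at a real point the term with \<open>J\<close> tends to \<open>0\<close> because \<open>J\<close> stays bounded.
\<close>

lemma slice_regular_isCont:
  assumes dom: "slice_domain \<Omega>" and sym: "symmetric_set \<Omega>" and f: "slice_regular_on \<Omega> f"
    and q: "q \<in> \<Omega>"
  shows "isCont f q"
proof -
  define I where "I = Quat 0 1 0 0"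
  have I: "I \<in> imag_units" unfolding I_def by (rule imag_units_nonempty)
  define \<phi> where "\<phi> = (\<lambda>z. f (slice_emb I z))"
  define Z where "Z q = Complex (qRe q) (norm (quat_vec q))" for q
  have opn: "open \<Omega>" using dom by (simp add: slice_domain_def)
  have qRe: "qRe q = inner q 1" for q by (simp add: inner_quat_def)
  have vec: "(quat_vec \<longlongrightarrow> quat_vec q) (at q)"
    unfolding quat_vec_def qRe by (intro tendsto_intros)
  have Z: "(Z \<longlongrightarrow> Z q) (at q)"
    unfolding Z_def Complex_eq qRe by (intro tendsto_intros vec)
  obtain J z where J: "J \<in> imag_units" and qz: "q = slice_emb J z" using quat_in_slice by blast
  have "slice_emb I z \<in> \<Omega>" using symmetric_set_slice_emb[OF sym J I] q qz by simp
  moreover have "Z q = z \<or> Z q = cnj z"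
    using imag_units_norm[OF J]
    by (auto simp: Z_def qz qRe_slice_emb[OF J] quat_vec_slice_emb[OF J] complex_eq_iff)
  ultimately have ZD: "slice_emb I (Z q) \<in> \<Omega>" "slice_emb I (cnj (Z q)) \<in> \<Omega>"
    using symmetric_set_slice_emb_cnj[OF sym I] by auto
  have "isCont \<phi> w" if "slice_emb I w \<in> \<Omega>" for w
    using f I that slice_hol_isCont[of I _ \<phi>] unfolding slice_regular_on_iff \<phi>_def by blast
  then have \<phi>: "((\<lambda>p. \<phi> (Z p)) \<longlongrightarrow> \<phi> (Z q)) (at q)" "((\<lambda>p. \<phi> (cnj (Z p))) \<longlongrightarrow> \<phi> (cnj (Z q))) (at q)"
    using ZD by (auto intro!: isCont_tendsto_compose[OF _ Z] isCont_tendsto_compose[OF _ tendsto_cnj[OF Z]])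
  let ?d = "\<lambda>p. \<phi> (Z p) - \<phi> (cnj (Z p))"
  have d: "(?d \<longlongrightarrow> ?d q) (at q)" by (intro tendsto_diff \<phi>)
  have "((\<lambda>p. sgn (quat_vec p) * I * ?d p) \<longlongrightarrow> sgn (quat_vec q) * I * ?d q) (at q)"
  proof (cases "quat_vec q = 0")
    case True
    then have "cnj (Z q) = Z q" by (simp add: Z_def complex_eq_iff)
    then have "((\<lambda>p. norm (?d p)) \<longlongrightarrow> 0) (at q)" using d tendsto_norm_zero by fastforce
    then have "((\<lambda>p. sgn (quat_vec p) * I * ?d p) \<longlongrightarrow> 0) (at q)"
      by (rule Lim_null_comparison[rotated])
         (auto intro!: always_eventually simp: norm_mult imag_units_norm[OF I] norm_sgn)
    then show ?thesis using True by simp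
  next
    case False
    then show ?thesis by (intro tendsto_mult tendsto_const d tendsto_sgn[OF vec False])
  qed
  then have "(slice_ext I \<phi> \<longlongrightarrow> slice_ext I \<phi> q) (at q)"
    unfolding slice_ext_def Let_def Z_def[symmetric]
    by (intro tendsto_scaleR tendsto_const tendsto_diff[OF tendsto_add[OF \<phi>]])
  moreover have "eventually (\<lambda>p. p \<in> \<Omega>) (at q)"
    using opn q by (rule eventually_at_in_open')
  moreover have eq: "slice_ext I \<phi> p = f p" if "p \<in> \<Omega>" for p
    using representation_formula[OF dom sym f I that] by (simp add: \<phi>_def)
  ultimately have "(f \<longlongrightarrow> slice_ext I \<phi> q) (at q)"
    by (rule Lim_transform_eventually[OF _ eventually_mono])
  then have "(f \<longlongrightarrow> f q) (at q)" unfolding eq[OF q] .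
  then show ?thesis by (simp add: isCont_def)
qed


section \<open>The regular product with a linear factor\<close>

text \<open>
  \<open>F\<close> and \<open>G J\<close> are the parts of \<open>f\<close> that commute and anticommute with \<open>I\<close>.
\<close>

lemma slice_splitting_exists:
  assumes I: "I \<in> imag_units" and J: "J \<in> imag_units" and orth: "inner I J = 0"
    and f: "slice_regular_on \<Omega> f"
  shows "\<exists>F G. slice_splitting \<Omega> I J f F G"
proof -
  define F where "F q = (1 / 2) *\<^sub>R (f q - I * (f q * I))" for q
  define G where "G q = - ((1 / 2) *\<^sub>R (f q * J + I * (f q * (I * J))))" for q
  have JI: "J * I = - (I * J)" using imag_units_anticommute[OF I J orth] .
  note rules = imag_units_square[OF I] imag_units_square_left[OF I] imag_units_square[OF J]
    imag_units_square_left[OF J] JI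
  have hol: "holomorphic_on_slice I (\<Omega> \<inter> slice I) (\<lambda>q. f q * c + I * (f q * d))" for c d
    using f I unfolding holomorphic_on_slice_iff[OF I] slice_regular_on_iff
    by (intro slice_hol_add slice_hol_mult_unit_left slice_hol_mult_right) blast+
  have FG: "F = (\<lambda>q. f q * ((1 / 2) *\<^sub>R 1) + I * (f q * (- (1 / 2) *\<^sub>R I)))"
    "G = (\<lambda>q. f q * (- (1 / 2) *\<^sub>R J) + I * (f q * (- (1 / 2) *\<^sub>R (I * J))))"
    by (simp_all add: F_def G_def fun_eq_iff algebra_simps)
  have "holomorphic_on_slice I (\<Omega> \<inter> slice I) F" by (subst FG(1)) (rule hol)
  moreover have "holomorphic_on_slice I (\<Omega> \<inter> slice I) G" by (subst FG(2)) (rule hol)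
  moreover have "F q \<in> slice I" for q
    by (rule commuting_imp_in_slice[OF I]) (simp add: F_def algebra_simps rules)
  moreover have "G q \<in> slice I" for q
    by (rule commuting_imp_in_slice[OF I]) (simp add: G_def algebra_simps rules)
  moreover have "f q = F q + G q * J" for q
  proof -
    have "F q + G q * J = (1 / 2) *\<^sub>R (f q + f q)"
      unfolding F_def G_def by (simp add: algebra_simps rules)
    then show ?thesis by (simp flip: scaleR_2)
  qed
  ultimately show ?thesis unfolding slice_splitting_def by blast
qed

lemma orthogonal_unit_mult_slice:
  assumes "I \<in> imag_units" "J \<in> imag_units" "inner I J = 0" "w \<in> slice I"
  shows "J * w = qcnj w * J"
proof -
  obtain z where "w = slice_emb I z" using assms(4) by (auto simp: slice_eq_range)
  then show ?thesis
    using imag_units_anticommute[OF assms(1-3)]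
    by (simp add: qcnj_slice_emb[OF assms(1)]) (simp add: slice_emb_altdef algebra_simps)
qed

lemma slice_commute: "w \<in> slice I \<Longrightarrow> w * I = I * w"
  by (auto simp: slice_eq_range slice_emb_commute)

text \<open>
  The product of the definition, for a first factor with value \<open>F + G * J\<close> and a second factor that
  takes the values \<open>a + I * b\<close> at a point and \<open>a - I * b\<close> at its conjugate. The result no longer
  mentions the splitting: moving \<open>J\<close> past elements of the slice conjugates them, and this absorbs
  the conjugations in the formula.
\<close>

lemma splitting_product_stem:
  assumes I: "I \<in> imag_units" and J: "J \<in> imag_units" and orth: "inner I J = 0"
    and sl: "F \<in> slice I" "G \<in> slice I" "H' \<in> slice I" "K' \<in> slice I"
    and g: "H + K * J = a + I * b" "H' + K' * J = a - I * b"
  shows "(F * H - G * qcnj K') + (F * K + G * qcnj H') * J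
       = (F + G * J) * a + I * ((F + G * J) * b)"
proof -
  have "J * (H' + K' * J) = qcnj H' * J - qcnj K'"
    using orthogonal_unit_mult_slice[OF I J orth sl(3)] orthogonal_unit_mult_slice[OF I J orth sl(4)]
    by (simp add: distrib_left mult.assoc[symmetric]) (simp add: mult.assoc imag_units_square[OF J])
  then have "F * (H + K * J) + G * (J * (H' + K' * J))
      = F * (H + K * J) + G * (qcnj H' * J - qcnj K')"
    by simp
  then have "(F * H - G * qcnj K') + (F * K + G * qcnj H') * J
      = F * (H + K * J) + G * (J * (H' + K' * J))"
    by (simp only:) (simp add: algebra_simps)
  also have "\<dots> = F * a + F * I * b + G * (J * a) - G * (J * I) * b"
    unfolding g by (simp add: algebra_simps)
  also have "\<dots> = F * a + F * I * b + G * (J * a) + G * I * J * b"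
    by (simp add: imag_units_anticommute[OF I J orth] mult.assoc)
  also have "\<dots> = (F + G * J) * a + I * ((F + G * J) * b)"
    unfolding slice_commute[OF sl(1)] slice_commute[OF sl(2)] by (simp add: algebra_simps)
  finally show ?thesis .
qed

text \<open>
  Multiplying pointwise by \<open>z - q\<^sub>0\<close> on the slice of \<open>q\<^sub>0\<close> and then extending gives, on the slice of
  \<open>I\<close>, exactly the value found in the preceding lemma, with \<open>q - q\<^sub>0\<close> as the first factor.
\<close>

lemma slice_ext_linear_factor:
  assumes I0: "I0 \<in> imag_units" and q0: "q0 \<in> slice I0" and I: "I \<in> imag_units"
    and g: "g (slice_emb I0 z) = a + I0 * b" "g (slice_emb I0 (cnj z)) = a - I0 * b"
  shows "slice_ext I0 (\<lambda>z. (slice_emb I0 z - q0) * g (slice_emb I0 z)) (slice_emb I z)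
       = (slice_emb I z - q0) * a + I * ((slice_emb I z - q0) * b)"
proof -
  let ?p = "(slice_emb I0 z - q0) * g (slice_emb I0 z)"
  let ?m = "(slice_emb I0 (cnj z) - q0) * g (slice_emb I0 (cnj z))"
  have c: "q0 * I0 = I0 * q0" by (rule slice_commute[OF q0])
  have c': "q0 * (I0 * w) = I0 * (q0 * w)" for w by (simp add: c flip: mult.assoc)
  have "?p + ?m = 2 *\<^sub>R (Re z *\<^sub>R a - q0 * a - Im z *\<^sub>R b)"
    unfolding g scaleR_2 by (simp add: slice_emb_altdef algebra_simps imag_units_square_left[OF I0] c')
  moreover have "I0 * (?p - ?m) = - (2 *\<^sub>R (Im z *\<^sub>R a + Re z *\<^sub>R b - q0 * b))"
    unfolding g scaleR_2 by (simp add: slice_emb_altdef algebra_simps imag_units_square_left[OF I0] c')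
  ultimately have "slice_ext I0 (\<lambda>z. (slice_emb I0 z - q0) * g (slice_emb I0 z)) (slice_emb I z)
      = (Re z *\<^sub>R a - q0 * a - Im z *\<^sub>R b) + I * (Im z *\<^sub>R a + Re z *\<^sub>R b - q0 * b)"
    by (simp only: slice_ext_slice_emb[OF I] mult.assoc) (simp flip: scaleR_add_right)
  also have "\<dots> = (slice_emb I z - q0) * a + I * ((slice_emb I z - q0) * b)"
    by (simp add: slice_emb_altdef algebra_simps imag_units_square_left[OF I])
  finally show ?thesis .
qed

lemma slice_regular_diff_const: "slice_regular_on \<Omega> (\<lambda>p. p - q0)"
  unfolding slice_regular_on_iff
  using slice_hol_add[OF slice_hol_emb slice_hol_const, of _ _ "- q0"] by simp

text \<open>
  Uniqueness in the definition of the product holds because splittings exist on every slice, so the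
  defining condition prescribes the value at each point of \<open>\<Omega>\<close>.
\<close>

lemma regular_prod_linear_factor:
  assumes dom: "slice_domain \<Omega>" and sym: "symmetric_set \<Omega>" and g: "slice_regular_on \<Omega> g"
    and I0: "I0 \<in> imag_units" and q0: "q0 \<in> slice I0"
  shows "regular_prod \<Omega> (\<lambda>p. p - q0) g =
    restrict (slice_ext I0 (\<lambda>z. (slice_emb I0 z - q0) * g (slice_emb I0 z))) \<Omega>" (is "_ = restrict ?h \<Omega>")
  unfolding regular_prod_def
proof (rule the_equality)
  have opn: "open \<Omega>" using dom by (simp add: slice_domain_def)
  obtain z0 where z0: "q0 = slice_emb I0 z0" using q0 by (auto simp: slice_eq_range)
  obtain a b where ab: "\<And>J z. J \<in> imag_units \<Longrightarrow> slice_emb J z \<in> \<Omega> \<Longrightarrow> g (slice_emb J z) = a z + J * b z"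
    using slice_regular_imp_slice_function[OF dom sym g] slice_functionE by metis
  have "slice_regular_on \<Omega> ?h"
    using g I0 unfolding z0 slice_emb_diff[symmetric]
    by (intro slice_regular_on_slice_ext[OF sym I0] slice_hol_mult_emb_left[OF I0])
       (auto simp: slice_regular_on_iff)
  then have "slice_regular_on \<Omega> (restrict ?h \<Omega>)"
    by (rule slice_regular_on_cong[OF opn]) simp
  moreover have "restrict ?h \<Omega> q = (F q * H q - G q * qcnj (K (qcnj q)))
                + (F q * K q + G q * qcnj (H (qcnj q))) * J"
    if I: "I \<in> imag_units" and J: "J \<in> imag_units" and orth: "inner I J = 0"
      and F: "slice_splitting \<Omega> I J (\<lambda>p. p - q0) F G" and H: "slice_splitting \<Omega> I J g H K"
      and q: "q \<in> \<Omega> \<inter> slice I" for I J F G H K q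
  proof -
    obtain z where z: "q = slice_emb I z" using q by (auto simp: slice_eq_range)
    have zI: "slice_emb I z \<in> \<Omega>" "slice_emb (- I) z \<in> \<Omega>" "slice_emb I0 z \<in> \<Omega>" "slice_emb (- I0) z \<in> \<Omega>"
      using q z symmetric_set_slice_emb[OF sym I] I I0 imag_units_uminus by auto
    have cq: "qcnj q = slice_emb (- I) z" "qcnj q = slice_emb I (cnj z)"
      by (simp_all add: z qcnj_slice_emb[OF I] slice_emb_cnj)
    have "qcnj q \<in> \<Omega>" unfolding cq(1) by (rule zI)
    moreover have "qcnj q \<in> slice I" unfolding cq(2) slice_eq_range by simp
    ultimately have q': "qcnj q \<in> \<Omega> \<inter> slice I" by blast
    have "H q + K q * J = a z + I * b z"
      using H q ab[OF I zI(1)] unfolding slice_splitting_def z by metis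
    moreover have "H (qcnj q) + K (qcnj q) * J = a z - I * b z"
      using H q' ab[OF imag_units_uminus[OF I] zI(2)] unfolding slice_splitting_def cq(1)
      by (metis diff_conv_add_uminus minus_mult_left)
    moreover have "F q \<in> slice I" "G q \<in> slice I" "q - q0 = F q + G q * J"
      "H (qcnj q) \<in> slice I" "K (qcnj q) \<in> slice I"
      using F H q q' unfolding slice_splitting_def by auto
    ultimately have "(F q * H q - G q * qcnj (K (qcnj q))) + (F q * K q + G q * qcnj (H (qcnj q))) * J
        = (q - q0) * a z + I * ((q - q0) * b z)"
      by (simp only: splitting_product_stem[OF I J orth])
    moreover have "g (slice_emb I0 (cnj z)) = a z - I0 * b z"
      using ab[OF imag_units_uminus[OF I0] zI(4)] by (simp add: slice_emb_cnj)
    ultimately show ?thesis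
      using slice_ext_linear_factor[where g = g, OF I0 q0 I ab[OF I0 zI(3)]] q z by simp
  qed
  ultimately show "restrict ?h \<Omega> \<in> extensional \<Omega> \<and> slice_regular_on \<Omega> (restrict ?h \<Omega>) \<and>
     (\<forall>I\<in>imag_units. \<forall>J\<in>imag_units. inner I J = 0 \<longrightarrow>
       (\<forall>F G H K. slice_splitting \<Omega> I J (\<lambda>p. p - q0) F G \<and> slice_splitting \<Omega> I J g H K \<longrightarrow>
         (\<forall>z\<in>\<Omega> \<inter> slice I.
            restrict ?h \<Omega> z = (F z * H z - G z * qcnj (K (qcnj z)))
                + (F z * K z + G z * qcnj (H (qcnj z))) * J)))" (is "?P (restrict ?h \<Omega>)")
    by (intro conjI ballI impI allI) auto
  then have P: "?P (restrict ?h \<Omega>)" .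
  fix h assume h: "?P h"
  show "h = restrict ?h \<Omega>"
  proof (rule extensionalityI[of _ \<Omega>])
    fix q assume q: "q \<in> \<Omega>"
    obtain I z where I: "I \<in> imag_units" and z: "q = slice_emb I z" using quat_in_slice by blast
    obtain J where J: "J \<in> imag_units" "inner I J = 0"
      using imag_units_orthogonal_exists[OF I] by blast
    obtain F G H K where s: "slice_splitting \<Omega> I J (\<lambda>p. p - q0) F G" "slice_splitting \<Omega> I J g H K"
      using slice_splitting_exists[OF I J slice_regular_diff_const[of \<Omega> q0]]
        slice_splitting_exists[OF I J g] by blast
    have qI: "q \<in> \<Omega> \<inter> slice I" using q z by (auto simp: slice_eq_range)
    show "h q = restrict ?h \<Omega> q"
      using h[THEN conjunct2, THEN conjunct2, rule_format, OF I J conjI[OF s] qI]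
        P[THEN conjunct2, THEN conjunct2, rule_format, OF I J conjI[OF s] qI]
      by (simp only:)
  qed (use h in auto)
qed

section \<open>The operator R\<close>

lemma regular_prod_linear_factor_iff:
  assumes dom: "slice_domain \<Omega>" and sym: "symmetric_set \<Omega>" and f: "slice_regular_on \<Omega> f"
    and g: "slice_regular_on \<Omega> g" and I: "I \<in> imag_units" and q0: "q0 \<in> slice I"
  shows "(\<forall>q\<in>\<Omega>. f q = f q0 + regular_prod \<Omega> (\<lambda>p. p - q0) g q) \<longleftrightarrow>
    (\<forall>z. slice_emb I z \<in> \<Omega> \<longrightarrow>
       f (slice_emb I z) = f q0 + (slice_emb I z - q0) * g (slice_emb I z))" (is "?L \<longleftrightarrow> ?R")
proof -
  let ?h = "slice_ext I (\<lambda>z. (slice_emb I z - q0) * g (slice_emb I z))"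
  have h: "regular_prod \<Omega> (\<lambda>p. p - q0) g q = ?h q" if "q \<in> \<Omega>" for q
    using that regular_prod_linear_factor[OF dom sym g I q0] by simp
  have "slice_function \<Omega> (\<lambda>q. f q0 + ?h q)"
  proof -
    obtain a b where "\<And>J z. J \<in> imag_units \<Longrightarrow> slice_emb J z \<in> \<Omega> \<Longrightarrow> ?h (slice_emb J z) = a z + J * b z"
      using slice_functionE[OF slice_function_slice_ext] by blast
    then show ?thesis by (intro slice_functionI[of _ _ "\<lambda>z. f q0 + a z" b]) (simp add: add.assoc)
  qed
  note eqI = slice_function_eqI[OF sym slice_regular_imp_slice_function[OF dom sym f] this I]
  show ?thesis
  proof
    assume L: ?L
    show ?R
    proof (intro allI impI)
      fix z assume z: "slice_emb I z \<in> \<Omega>"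
      then have "f (slice_emb I z) = f q0 + ?h (slice_emb I z)" using L h[OF z] by metis
      then show "f (slice_emb I z) = f q0 + (slice_emb I z - q0) * g (slice_emb I z)"
        by (simp only: slice_ext_same_slice[OF I])
    qed
  next
    assume R: ?R
    have "f q = f q0 + ?h q" if "q \<in> \<Omega>" for q
      using that by (rule eqI[rotated]) (simp only: slice_ext_same_slice[OF I] R)
    then show ?L using h by (metis (no_types, lifting))
  qed
qed

text \<open>
  The factor \<open>z - z0\<close> is invertible away from \<open>z0\<close>; continuity covers \<open>z0\<close> itself, and agreement on
  one slice suffices.
\<close>

lemma linear_factor_cancel:
  assumes dom: "slice_domain \<Omega>" and sym: "symmetric_set \<Omega>"
    and g: "slice_regular_on \<Omega> g" and h: "slice_regular_on \<Omega> h"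
    and I: "I \<in> imag_units" and z0: "slice_emb I z0 \<in> \<Omega>"
    and eq: "\<And>z. slice_emb I z \<in> \<Omega> \<Longrightarrow> slice_emb I (z - z0) * g (slice_emb I z)
               = slice_emb I (z - z0) * h (slice_emb I z)"
    and q: "q \<in> \<Omega>"
  shows "g q = h q"
proof (rule slice_function_eqI[OF sym _ _ I _ q])
  let ?\<phi> = "\<lambda>z. g (slice_emb I z) - h (slice_emb I z)"
  have off: "?\<phi> z = 0" if "slice_emb I z \<in> \<Omega>" "z \<noteq> z0" for z
    using eq[OF that(1)] that(2) slice_emb_eq_0_iff[OF I, of "z - z0"] by simp
  have "isCont (\<lambda>z. g (slice_emb I z)) z0" "isCont (\<lambda>z. h (slice_emb I z)) z0"
    using g h I z0 slice_hol_isCont unfolding slice_regular_on_iff by blast+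
  then have "(?\<phi> \<longlongrightarrow> ?\<phi> z0) (at z0)" by (intro tendsto_diff) (simp_all add: isCont_def)
  moreover have "eventually (\<lambda>z. ?\<phi> z = 0) (at z0)"
  proof -
    have "open (slice_emb I -` \<Omega>)"
      using dom by (intro open_vimage_slice_emb) (simp add: slice_domain_def)
    then have "eventually (\<lambda>z. z \<in> slice_emb I -` \<Omega> - {z0}) (at z0)"
      using z0 by (intro eventually_at_in_open) auto
    then show ?thesis by eventually_elim (use off in auto)
  qed
  ultimately have "?\<phi> z0 = 0"
    by (rule tendsto_unique[OF trivial_limit_at _ tendsto_eventually])
  with off show "g (slice_emb I z) = h (slice_emb I z)" if "slice_emb I z \<in> \<Omega>" for z
    using that by (cases "z = z0") auto
qed (use slice_regular_imp_slice_function[OF dom sym] g h in auto)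

text \<open>
  Existence: extend the divided difference of \<open>f\<close> from the slice of \<open>q\<^sub>0\<close>. Uniqueness: cancel the
  linear factor on that slice.
\<close>

lemma R_op_on_slice:
  assumes dom: "slice_domain \<Omega>" and sym: "symmetric_set \<Omega>" and f: "slice_regular_on \<Omega> f"
    and I: "I \<in> imag_units" and z0: "slice_emb I z0 \<in> \<Omega>"
  shows slice_regular_R_op: "slice_regular_on \<Omega> (R_op \<Omega> (slice_emb I z0) f)"
    and R_op_eq: "slice_emb I z \<in> \<Omega> \<Longrightarrow> f (slice_emb I z) = f (slice_emb I z0) +
           slice_emb I (z - z0) * R_op \<Omega> (slice_emb I z0) f (slice_emb I z)"
proof -
  let ?q0 = "slice_emb I z0"
  let ?P = "\<lambda>g. g \<in> extensional \<Omega> \<and> slice_regular_on \<Omega> g \<and>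
     (\<forall>q\<in>\<Omega>. f q = f ?q0 + regular_prod \<Omega> (\<lambda>p. p - ?q0) g q)"
  have opn: "open \<Omega>" using dom by (simp add: slice_domain_def)
  have q0: "?q0 \<in> slice I" by (simp add: slice_eq_range)
  note iff = regular_prod_linear_factor_iff[OF dom sym f _ I q0]
  have "slice_hol I (slice_emb I -` \<Omega>) (\<lambda>z. f (slice_emb I z))"
    using f I by (simp add: slice_regular_on_iff)
  then obtain \<psi> where hol: "slice_hol I (slice_emb I -` \<Omega>) \<psi>"
    and \<psi>: "\<And>z. f (slice_emb I z) = f ?q0 + slice_emb I (z - z0) * \<psi> z"
    using slice_hol_divided_difference[OF I open_vimage_slice_emb[OF opn], of z0] z0
    by (metis vimageI2)
  define g where "g = restrict (slice_ext I \<psi>) \<Omega>"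
  have g: "slice_regular_on \<Omega> g"
    unfolding g_def
    by (rule slice_regular_on_cong[OF opn slice_regular_on_slice_ext[OF sym I hol]]) simp
  have "g (slice_emb I z) = \<psi> z" if "slice_emb I z \<in> \<Omega>" for z
    using that by (simp add: g_def slice_ext_same_slice[OF I])
  then have "\<forall>z. slice_emb I z \<in> \<Omega> \<longrightarrow>
      f (slice_emb I z) = f ?q0 + (slice_emb I z - ?q0) * g (slice_emb I z)"
    using \<psi> by (metis slice_emb_diff)
  then have "?P g" using g iff[OF g] by (simp add: g_def)
  moreover have "h = g" if h: "?P h" for h
  proof (rule extensionalityI[of _ \<Omega>])
    fix q assume q: "q \<in> \<Omega>"
    have hr: "slice_regular_on \<Omega> h" using h by blast
    have "\<forall>z. slice_emb I z \<in> \<Omega> \<longrightarrow> f (slice_emb I z) = f ?q0 + (slice_emb I z - ?q0) * h (slice_emb I z)"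
      using h iff[OF hr] by blast
    moreover have "\<forall>z. slice_emb I z \<in> \<Omega> \<longrightarrow> f (slice_emb I z) = f ?q0 + (slice_emb I z - ?q0) * g (slice_emb I z)"
      using \<open>?P g\<close> iff[OF g] by blast
    ultimately show "h q = g q"
      by (intro linear_factor_cancel[OF dom sym hr g I z0 _ q]) (metis add_left_cancel slice_emb_diff)
  qed (use h \<open>?P g\<close> in auto)
  ultimately have "?P (R_op \<Omega> ?q0 f)" unfolding R_op_def by (rule theI)
  then show "slice_regular_on \<Omega> (R_op \<Omega> ?q0 f)"
    and "slice_emb I z \<in> \<Omega> \<Longrightarrow> f (slice_emb I z) = f ?q0 +
           slice_emb I (z - z0) * R_op \<Omega> ?q0 f (slice_emb I z)"
    using iff[of "R_op \<Omega> ?q0 f"] by (auto simp: slice_emb_diff)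
qed

section \<open>The quadratic expansion and the derivative\<close>

text \<open>
  The monic real quadratic polynomial that vanishes on the sphere of \<open>q0\<close> (for real \<open>q0\<close>, the
  square of \<open>q - q0\<close>).
\<close>

definition char_quadratic :: "quat \<Rightarrow> quat \<Rightarrow> quat" where
  "char_quadratic q0 q = q * q - (2 * qRe q0) *\<^sub>R q + (norm q0)\<^sup>2 *\<^sub>R 1"

lemma norm_slice_emb: "I \<in> imag_units \<Longrightarrow> norm (slice_emb I z) = cmod z"
  by (auto simp: slice_emb_altdef norm_quat_def cmod_def imag_units_iff power_mult_distrib
      simp flip: distrib_left)

lemma char_quadratic_slice_emb:
  assumes I: "I \<in> imag_units" and J: "J \<in> imag_units"
  shows "char_quadratic (slice_emb I z0) (slice_emb J z) = slice_emb J ((z - z0) * (z - cnj z0))"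
proof -
  have p: "(z - z0) * (z - cnj z0) = z * z - (2 * Re z0) *\<^sub>R z + (cmod z0)\<^sup>2 *\<^sub>R 1"
    unfolding cmod_power2 by (simp add: complex_eq_iff algebra_simps power2_eq_square)
  show ?thesis
    unfolding p char_quadratic_def qRe_slice_emb[OF I] norm_slice_emb[OF I]
    by (simp add: slice_emb_add slice_emb_diff slice_emb_scaleR slice_emb_mult[OF J])
qed

text \<open>
  On the slice of \<open>q0\<close> this is the defining equation of \<open>R\<close> used twice. The right-hand side is a
  slice function because the quadratic has real coefficients: its values at \<open>x + J y\<close> are \<open>P + J Q\<close>
  with real \<open>P\<close> and \<open>Q\<close> that are the same for all \<open>J\<close>.
\<close>

lemma R_op_quadratic_expansion:
  assumes dom: "slice_domain \<Omega>" and sym: "symmetric_set \<Omega>" and f: "slice_regular_on \<Omega> f"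
    and q0: "q0 \<in> \<Omega>" and q: "q \<in> \<Omega>"
  shows "f q = f q0 + (q - q0) * R_op \<Omega> q0 f (qcnj q0)
    + char_quadratic q0 q * R_op \<Omega> (qcnj q0) (R_op \<Omega> q0 f) q"
proof -
  obtain I z0 where I: "I \<in> imag_units" and z0: "q0 = slice_emb I z0" using quat_in_slice by blast
  let ?g = "R_op \<Omega> q0 f" and ?k = "R_op \<Omega> (qcnj q0) (R_op \<Omega> q0 f)"
  let ?A = "?g (qcnj q0)"
  have cz: "qcnj q0 = slice_emb I (cnj z0)" by (simp add: z0 qcnj_slice_emb[OF I])
  have cz_in: "slice_emb I (cnj z0) \<in> \<Omega>" using symmetric_set_slice_emb_cnj[OF sym I] q0 z0 by simp
  note step1 = R_op_on_slice[OF dom sym f I q0[unfolded z0], folded z0]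
  note step2 = R_op_on_slice[OF dom sym step1(1) I cz_in, folded cz]
  obtain a b where ab: "\<And>J z. J \<in> imag_units \<Longrightarrow> slice_emb J z \<in> \<Omega> \<Longrightarrow> ?k (slice_emb J z) = a z + J * b z"
    using slice_regular_imp_slice_function[OF dom sym step2(1)] slice_functionE by metis
  let ?p = "\<lambda>z. (z - z0) * (z - cnj z0)"
  have "slice_function \<Omega> (\<lambda>q. f q0 + (q - q0) * ?A + char_quadratic q0 q * ?k q)"
  proof (rule slice_functionI)
    fix J z assume J: "J \<in> imag_units" and z: "slice_emb J z \<in> \<Omega>"
    show "f q0 + (slice_emb J z - q0) * ?A + char_quadratic q0 (slice_emb J z) * ?k (slice_emb J z)
      = (f q0 + Re z *\<^sub>R ?A - q0 * ?A + Re (?p z) *\<^sub>R a z - Im (?p z) *\<^sub>R b z)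
        + J * (Im z *\<^sub>R ?A + Im (?p z) *\<^sub>R a z + Re (?p z) *\<^sub>R b z)"
      unfolding z0 char_quadratic_slice_emb[OF I J] ab[OF J z, unfolded z0]
      unfolding slice_emb_altdef[of J]
      by (simp add: algebra_simps imag_units_square_left[OF J] del: times_complex.sel)
  qed
  moreover have "f (slice_emb I z) = f q0 + (slice_emb I z - q0) * ?A
      + char_quadratic q0 (slice_emb I z) * ?k (slice_emb I z)" if z: "slice_emb I z \<in> \<Omega>" for z
  proof -
    have "f (slice_emb I z) = f q0 + slice_emb I (z - z0) * (?A + slice_emb I (z - cnj z0) * ?k (slice_emb I z))"
      using step1(2)[OF z] step2(2)[OF z] by simp
    also have "\<dots> = f q0 + (slice_emb I z - q0) * ?A + slice_emb I (?p z) * ?k (slice_emb I z)"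
      by (simp add: slice_emb_mult[OF I] slice_emb_diff z0 distrib_left mult.assoc)
    finally show ?thesis by (simp add: z0 char_quadratic_slice_emb[OF I I])
  qed
  ultimately show ?thesis
    using slice_function_eqI[OF sym slice_regular_imp_slice_function[OF dom sym f] _ I _ q] by blast
qed

lemma char_quadratic_along_line:
  "char_quadratic q0 (q0 + t *\<^sub>R v) = t *\<^sub>R (q0 * v - v * qcnj q0 + t *\<^sub>R (v * v))"
  by (simp add: char_quadratic_def quat_eq_iff qcnj_def norm_quat_def power2_eq_square)
     (simp add: algebra_simps)

lemma slice_regular_directional_derivative:
  assumes dom: "slice_domain \<Omega>" and sym: "symmetric_set \<Omega>" and f: "slice_regular_on \<Omega> f"
    and q0: "q0 \<in> \<Omega>"
  shows "((\<lambda>t::real. (f (q0 + t *\<^sub>R v) - f q0) /\<^sub>R t) \<longlongrightarrow>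
    v * R_op \<Omega> q0 f (qcnj q0)
      + (q0 * v - v * qcnj q0) * R_op \<Omega> (qcnj q0) (R_op \<Omega> q0 f) q0) (at 0)"
proof -
  let ?A = "R_op \<Omega> q0 f (qcnj q0)" and ?k = "R_op \<Omega> (qcnj q0) (R_op \<Omega> q0 f)"
  obtain I z0 where I: "I \<in> imag_units" and z0: "q0 = slice_emb I z0" using quat_in_slice by blast
  have "slice_emb I (cnj z0) \<in> \<Omega>" using symmetric_set_slice_emb_cnj[OF sym I] q0 z0 by simp
  from slice_regular_R_op[OF dom sym slice_regular_R_op[OF dom sym f I q0[unfolded z0]] I this]
  have "slice_regular_on \<Omega> ?k" by (simp add: z0 qcnj_slice_emb[OF I])
  then have cont: "isCont ?k q0" by (rule slice_regular_isCont[OF dom sym _ q0])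
  have line: "((\<lambda>t::real. q0 + t *\<^sub>R v) \<longlongrightarrow> q0) (at 0)"
    by (auto intro!: tendsto_eq_intros)
  have "((\<lambda>t. v * ?A + (q0 * v - v * qcnj q0 + t *\<^sub>R (v * v)) * ?k (q0 + t *\<^sub>R v)) \<longlongrightarrow>
      v * ?A + (q0 * v - v * qcnj q0 + 0 *\<^sub>R (v * v)) * ?k q0) (at 0)"
    by (intro tendsto_intros isCont_tendsto_compose[OF cont] line)
  moreover have "eventually (\<lambda>t. v * ?A + (q0 * v - v * qcnj q0 + t *\<^sub>R (v * v)) * ?k (q0 + t *\<^sub>R v)
      = (f (q0 + t *\<^sub>R v) - f q0) /\<^sub>R t) (at 0)"
  proof -
    have "open \<Omega>" using dom by (simp add: slice_domain_def)
    then have "eventually (\<lambda>t. q0 + t *\<^sub>R v \<in> \<Omega>) (at 0)"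
      using line q0 topological_tendstoD by blast
    moreover have "eventually (\<lambda>t::real. t \<noteq> 0) (at 0)" by (simp add: eventually_at_filter)
    ultimately show ?thesis
    proof eventually_elim
      case (elim t)
      then show ?case
        using R_op_quadratic_expansion[OF dom sym f q0 elim(1)]
        by (simp add: char_quadratic_along_line flip: scaleR_add_right)
    qed
  qed
  ultimately show ?thesis by (simp add: tendsto_cong)
qed

lemma sum_coord:
  assumes "quat_basis e"
  shows "(\<Sum>j<4. coord e q j *\<^sub>R e j) = q"
proof -
  have "(\<Sum>b\<in>e ` {..<4}. representation (e ` {..<4}) q b *\<^sub>R b) = q"
    using assms by (intro sum_representation_eq) (auto simp: quat_basis_def)
  then show ?thesis
    using assms by (simp add: coord_def quat_basis_def sum.reindex)
qed

lemma has_partial_derivative_iff: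
  assumes e: "quat_basis e" and i: "i < 4"
  shows "has_partial_derivative e i f d q \<longleftrightarrow>
    ((\<lambda>t. (f (q + t *\<^sub>R e i) - f q) /\<^sub>R t) \<longlongrightarrow> d) (at 0)"
proof -
  let ?c = "coord e q"
  have "(\<Sum>j<4. (?c(i := t)) j *\<^sub>R e j) = q + (t - ?c i) *\<^sub>R e i" for t
  proof -
    have "(\<Sum>j<4. (?c(i := t)) j *\<^sub>R e j)
        = (\<Sum>j<4. ?c j *\<^sub>R e j + (if j = i then (t - ?c i) *\<^sub>R e i else 0))"
      by (rule sum.cong) (auto simp: algebra_simps)
    also have "\<dots> = q + (t - ?c i) *\<^sub>R e i"
      using i by (simp only: sum.distrib sum_coord[OF e]) simp
    finally show ?thesis .
  qed
  then have "has_partial_derivative e i f d q \<longleftrightarrow>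
      ((\<lambda>t. norm (f (q + t *\<^sub>R e i) - f q - t *\<^sub>R d) / norm t) \<longlongrightarrow> 0) (at 0)"
    by (simp add: has_partial_derivative_def has_vector_derivative_def has_derivative_at
        bounded_linear_scaleR_left)
  also have "\<dots> \<longleftrightarrow> ((\<lambda>t. norm ((f (q + t *\<^sub>R e i) - f q) /\<^sub>R t - d)) \<longlongrightarrow> 0) (at 0)"
  proof (rule tendsto_cong)
    have "norm (f (q + t *\<^sub>R e i) - f q - t *\<^sub>R d) / norm t
        = norm ((f (q + t *\<^sub>R e i) - f q) /\<^sub>R t - d)" if "t \<noteq> 0" for t
    proof -
      have "(f (q + t *\<^sub>R e i) - f q) /\<^sub>R t - d = (f (q + t *\<^sub>R e i) - f q - t *\<^sub>R d) /\<^sub>R t"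
        using that by (simp add: scaleR_diff_right)
      then show ?thesis by (simp add: divide_inverse mult.commute)
    qed
    then show "eventually (\<lambda>t. norm (f (q + t *\<^sub>R e i) - f q - t *\<^sub>R d) / norm t
        = norm ((f (q + t *\<^sub>R e i) - f q) /\<^sub>R t - d)) (at 0)"
      by (auto simp: eventually_at_filter)
  qed
  also have "\<dots> \<longleftrightarrow> ((\<lambda>t. (f (q + t *\<^sub>R e i) - f q) /\<^sub>R t) \<longlongrightarrow> d) (at 0)"
    by (simp add: tendsto_norm_zero_iff Lim_null[symmetric])
  finally show ?thesis .
qed

theorem theorem6p1:
  fixes \<Omega> :: "quat set" and f :: "quat \<Rightarrow> quat" and q0 A1 A2 :: quat
  assumes "slice_domain \<Omega>" and "symmetric_set \<Omega>"
    and "slice_regular_on \<Omega> f"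
    and "q0 \<in> \<Omega>"
    and "A1 = R_op \<Omega> q0 f (qcnj q0)"
    and "A2 = R_op \<Omega> (qcnj q0) (R_op \<Omega> q0 f) q0"
  shows "(\<forall>v. norm v = 1 \<longrightarrow>
            ((\<lambda>t::real. (f (q0 + t *\<^sub>R v) - f q0) /\<^sub>R t)
               \<longlongrightarrow> v * A1 + (q0 * v - v * qcnj q0) * A2) (at 0)) \<and>
         (\<forall>e. quat_basis e \<longrightarrow> (\<forall>i\<in>{0,1,2,3}.
            has_partial_derivative e i f
              (e i * R_op \<Omega> q0 f (qcnj q0)
                + (q0 * e i - e i * qcnj q0) * R_op \<Omega> (qcnj q0) (R_op \<Omega> q0 f) q0) q0))"
proof (intro conjI allI impI ballI)
  fix v :: quat
  show "((\<lambda>t::real. (f (q0 + t *\<^sub>R v) - f q0) /\<^sub>R t)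
      \<longlongrightarrow> v * A1 + (q0 * v - v * qcnj q0) * A2) (at 0)"
    unfolding assms(5,6) by (rule slice_regular_directional_derivative[OF assms(1-4)])
next
  fix e :: "nat \<Rightarrow> quat" and i :: nat
  assume e: "quat_basis e" and "i \<in> {0,1,2,3}"
  then have "i < 4" by auto
  show "has_partial_derivative e i f
              (e i * R_op \<Omega> q0 f (qcnj q0)
                + (q0 * e i - e i * qcnj q0) * R_op \<Omega> (qcnj q0) (R_op \<Omega> q0 f) q0) q0"
    unfolding has_partial_derivative_iff[OF e \<open>i < 4\<close>]
    by (rule slice_regular_directional_derivative[OF assms(1-4)])
qed

end
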